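(* (1) Let $k$ be a positive integer. There exists $f_k$ so that $\mathcal{M}_{f_k}$ is variable $k$-curvature homogeneous but not variable $(k+1)$-curvature homogeneous. (2) The manifold $\mathcal{M}_{\frac12e^xy^2}$ is variable $k$-curvature homogeneous for all $k$, but is not homothety $1$-curvature homogeneous and hence not locally homogeneous. (3) Consider the following four properties of a pseudo-Riemannian manifold: (1a) $k$-curvature homogeneous; (1b) homothety $k$-curvature homogeneous; (2a) variable $k$-curvature homogeneous; (2b) variable homothety $k$-curvature homogeneous. Then one has the implications $$(1a)\Rightarrow(1b)\Rightarrow(2b)\quad\text{and}\quad(1a)\Rightarrow(2a)\Rightarrow(2b).$$ All other possible implications between these properties are false (in general).
   Context: For a smooth function $f=f(x,y)$, $\mathcal{M}_f$ is the $3$-dimensional Lorentzian manifold on a connected open subset of $\mathbb{R}^3$ (coordinates $(x,y,\tilde x)$) whose only (possibly) non-zero metric components are $g(\partial_x,\partial_x)=-2f(x,y)$ and $g(\partial_x,\partial_{\tilde x})=g(\partial_y,\partial_y)=1$; $\mathcal{M}_{\frac12e^xy^2}$ is taken on all of $\mathbb{R}^3$. A $k$-curvature model is a tuple $\mathfrak{M}_k=(V,\langle\cdot,\cdot\rangle,A^0,\dots,A^k)$ where $\langle\cdot,\cdot\rangle$ is a non-degenerate inner product on an $m$-dimensional real vector space $V$ and $A^i\in\otimes^{4+i}(V^* )$ satisfies the algebraic identities of $\nabla^iR$ (the $i$-th covariant derivative of the curvature tensor). Let $\mathcal{M}=(M,g)$ be a pseudo-Riemannian manifold. - (1a) $\mathcal{M}$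 is $k$-curvature homogeneous (with model $\mathfrak{M}_k$) if for any $P\in M$ there is an isometry $\phi_P:T_PM\to V$ so that $\phi_P^*A^\ell=\nabla^\ell R_P$ for $0\le\ell\le k$. - (1b) $\mathcal{M}$ is homothety $k$-curvature homogeneous (with model $\mathfrak{M}_k$) if for any $P\in M$ there are an isometry $\phi_P:T_PM\to V$ and a scaling factor $0\ne\lambda\in\mathbb{R}$ (depending on $P$) so that $\phi_P^*A^\ell=\lambda^{2+\ell}\nabla^\ell R_P$ for $0\le\ell\le k$. - (2a) $\mathcal{M}$ is variable $k$-curvature homogeneous (with model $\mathfrak{M}_k$) if for every $P\in M$ and every $0\le\ell\le k$ there is an isometry $\phi_{P,\ell}:T_PM\to V$ so that $\phi_{P,\ell}^*A^\ell=\nabla^\ell R_P$. - (2b) $\mathcal{M}$ is variable homothety $k$-curvature homogeneous (with model $\mathfrak{M}_k$) if for every $P\in M$ and every $0\le\ell\le k$ there are a linear isometry $\phi_{P,\ell}:T_PM\to V$ and a scaling factor $0\ne\lambda_\ell\in\mathbb{R}$ (depending on $P$) so that $\phi_{P,\ell}^*A^\ell=\lambda_\ell^{2+\ell}\nabla^\ell R_P$. When no model is mentioned, the property means that it holds for some $k$-curvature model. Locally homogeneous means that any point can be mapped to any other by an isometry between neighborhoods. *)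

theory Defs
  imports "HOL-Analysis.Analysis"
begin

section \<open>Smooth maps\<close>

abbreviation dir_deriv ::
  "('a::real_normed_vector \<Rightarrow> 'b::real_normed_vector) \<Rightarrow> 'a \<Rightarrow> 'a \<Rightarrow> 'b" where
  "dir_deriv f p v \<equiv> frechet_derivative f (at p) v"

primrec iter_deriv ::
  "'a list \<Rightarrow> ('a::real_normed_vector \<Rightarrow> 'b::real_normed_vector) \<Rightarrow> 'a \<Rightarrow> 'b" where
  "iter_deriv [] f = f"
| "iter_deriv (v # vs) f = iter_deriv vs (\<lambda>p. dir_deriv f p v)"

text \<open>Only used for open sets \<open>S\<close>, where it is the usual notion of a \<open>C\<close>-infinity map:
  every iterated directional derivative is again (Frechet) differentiable.\<close>

definition smooth_on ::
  "'a::real_normed_vector set \<Rightarrow> ('a \<Rightarrow> 'b::real_normed_vector) \<Rightarrow> bool" where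
  "smooth_on S f \<longleftrightarrow> (\<forall>vs. \<forall>p\<in>S. iter_deriv vs f differentiable (at p))"

section \<open>The curvature tensor and its covariant derivatives in coordinates\<close>

text \<open>A metric on an open subset of \<open>real^'n\<close> is given by its matrix field \<open>G\<close>. Vectors are
  regarded as constant-coefficient vector fields, whose Lie brackets vanish.\<close>

definition metric_form :: "(real^'n \<Rightarrow> real^'n^'n) \<Rightarrow> real^'n \<Rightarrow> real^'n \<Rightarrow> real^'n \<Rightarrow> real" where
  "metric_form G p v w = v \<bullet> (G p *v w)"

text \<open>\<open>christoffel G p u v\<close> is the Levi-Civita derivative of the constant field \<open>v\<close> in the
  direction \<open>u\<close>; the vector to which \<open>matrix_inv\<close> is applied is the Koszul formula.\<close>

definition christoffel :: "(real^'n \<Rightarrow> real^'n^'n) \<Rightarrow> real^'n \<Rightarrow> real^'n \<Rightarrow> real^'n \<Rightarrow> real^'n" where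
  "christoffel G p u v = matrix_inv (G p) *v
     (\<chi> i. (dir_deriv (\<lambda>q. metric_form G q v (axis i 1)) p u
           + dir_deriv (\<lambda>q. metric_form G q u (axis i 1)) p v
           - dir_deriv (\<lambda>q. metric_form G q u v) p (axis i 1)) / 2)"

text \<open>\<open>R(u,v)w\<close>, with the sign convention \<open>R(u,v) = [\<nabla>\<^sub>u, \<nabla>\<^sub>v] - \<nabla>\<^bsub>[u,v]\<^esub>\<close>.\<close>

definition curv_endo ::
  "(real^'n \<Rightarrow> real^'n^'n) \<Rightarrow> real^'n \<Rightarrow> real^'n \<Rightarrow> real^'n \<Rightarrow> real^'n \<Rightarrow> real^'n" where
  "curv_endo G p u v w =
     dir_deriv (\<lambda>q. christoffel G q v w) p u - dir_deriv (\<lambda>q. christoffel G q u w) p v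
     + christoffel G p u (christoffel G p v w) - christoffel G p v (christoffel G p u w)"

text \<open>\<open>nabla_curv G l p [x1, x2, x3, x4, y1, \<dots>, yl]\<close> is the value at \<open>p\<close> of the \<open>l\<close>-th covariant
  derivative of the curvature tensor, \<open>\<nabla>\<^sup>lR(x1, x2, x3, x4; y1, \<dots>, yl)\<close>, the last argument being
  the direction of the last differentiation. It is meaningful for lists of length \<open>4 + l\<close>.\<close>

primrec nabla_curv ::
  "(real^'n \<Rightarrow> real^'n^'n) \<Rightarrow> nat \<Rightarrow> real^'n \<Rightarrow> (real^'n) list \<Rightarrow> real" where
  "nabla_curv G 0 p vs = metric_form G p (curv_endo G p (vs ! 0) (vs ! 1) (vs ! 2)) (vs ! 3)"
| "nabla_curv G (Suc l) p vs =
     dir_deriv (\<lambda>q. nabla_curv G l q (butlast vs)) p (last vs)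
     - (\<Sum>s<4 + l. nabla_curv G l p ((butlast vs)[s := christoffel G p (last vs) (vs ! s)]))"

section \<open>Pseudo-Riemannian manifolds\<close>

text \<open>A chart is a pair of its domain and its coordinate map. \<open>metric M c\<close> is the matrix field of
  the metric in the chart \<open>c\<close>, as a function of the coordinates.\<close>

type_synonym ('a, 'n) chart = "'a set \<times> ('a \<Rightarrow> real^'n)"

record ('a, 'n::finite) pr_manifold =
  topol :: "'a topology"
  atlas :: "('a, 'n) chart set"
  metric :: "('a, 'n) chart \<Rightarrow> real^'n \<Rightarrow> real^'n^'n"

definition coord_rep ::
  "('a, 'n::finite) chart \<Rightarrow> ('a, 'n) chart \<Rightarrow> ('a \<Rightarrow> 'a) \<Rightarrow> real^'n \<Rightarrow> real^'n" where
  "coord_rep c d \<psi> = snd d \<circ> \<psi> \<circ> inv_into (fst c) (snd c)"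

text \<open>\<open>\<psi>\<close> is smooth on the open set \<open>W\<close> and pulls the metric back to the metric. Openness of the
  sets \<open>snd c ` D\<close> expresses that \<open>\<psi>\<close> is continuous on \<open>W\<close>.\<close>

definition isometric_on :: "('a, 'n::finite) pr_manifold \<Rightarrow> 'a set \<Rightarrow> ('a \<Rightarrow> 'a) \<Rightarrow> bool" where
  "isometric_on M W \<psi> \<longleftrightarrow> (\<forall>c\<in>atlas M. \<forall>d\<in>atlas M.
     let D = {P \<in> W \<inter> fst c. \<psi> P \<in> fst d} in
       open (snd c ` D) \<and> smooth_on (snd c ` D) (coord_rep c d \<psi>) \<and>
       (\<forall>p\<in>snd c ` D. \<forall>v w. metric_form (metric M c) p v w =
          metric_form (metric M d) (coord_rep c d \<psi> p)
            (dir_deriv (coord_rep c d \<psi>) p v) (dir_deriv (coord_rep c d \<psi>) p w)))"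

text \<open>The last conjunct, for the identity map, says that the transition maps are smooth and that
  the matrix fields in the various charts define one tensor field. Manifolds are not assumed to be
  connected.\<close>

definition pseudo_riemannian :: "('a, 'n::finite) pr_manifold \<Rightarrow> bool" where
  "pseudo_riemannian M \<longleftrightarrow>
     Hausdorff_space (topol M) \<and> second_countable (topol M) \<and>
     (\<Union>c\<in>atlas M. fst c) = topspace (topol M) \<and>
     (\<forall>c\<in>atlas M. openin (topol M) (fst c) \<and> open (snd c ` fst c) \<and>
        homeomorphic_map (subtopology (topol M) (fst c)) (top_of_set (snd c ` fst c)) (snd c) \<and>
        smooth_on (snd c ` fst c) (metric M c) \<and>
        (\<forall>p\<in>snd c ` fst c. transpose (metric M c p) = metric M c p \<and> invertible (metric M c p))) \<and>
     isometric_on M (topspace (topol M)) (\<lambda>P. P)"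

definition locally_homogeneous :: "('a, 'n::finite) pr_manifold \<Rightarrow> bool" where
  "locally_homogeneous M \<longleftrightarrow> (\<forall>P\<in>topspace (topol M). \<forall>Q\<in>topspace (topol M).
     \<exists>U W \<psi>. openin (topol M) U \<and> openin (topol M) W \<and> P \<in> U \<and> Q \<in> W \<and>
       \<psi> P = Q \<and> bij_betw \<psi> U W \<and> isometric_on M U \<psi> \<and> isometric_on M W (inv_into U \<psi>))"

text \<open>The manifold \<open>M\<^sub>f\<close> on \<open>U\<close>; the coordinates \<open>(x, y, \<tilde>x)\<close> of the point \<open>p\<close> are
  \<open>p $ 1\<close>, \<open>p $ 2\<close> and \<open>p $ 3\<close>.\<close>

definition Mf :: "(real^3) set \<Rightarrow> (real \<Rightarrow> real \<Rightarrow> real) \<Rightarrow> (real^3, 3) pr_manifold" where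
  "Mf U f = \<lparr> topol = top_of_set U, atlas = {(U, \<lambda>p. p)},
     metric = (\<lambda>c p. vector [vector [- 2 * f (p $ 1) (p $ 2), 0, 1],
                             vector [0, 1, 0],
                             vector [1, 0, 0]]) \<rparr>"

section \<open>Curvature models\<close>

text \<open>In a model, \<open>V\<close> is the type \<open>'v\<close>; the inner product supplied by the class
  \<open>euclidean_space\<close> plays no role, the model's inner product being \<open>B\<close>. An element of
  \<open>\<otimes>\<^sup>r V*\<close> is a function on lists, of which only the values on lists of length \<open>r\<close>
  matter.\<close>

definition nondegenerate_inner_product :: "('v::euclidean_space \<Rightarrow> 'v \<Rightarrow> real) \<Rightarrow> bool" where
  "nondegenerate_inner_product B \<longleftrightarrow>
     bilinear B \<and> (\<forall>v w. B v w = B w v) \<and> (\<forall>v. (\<forall>w. B v w = 0) \<longrightarrow> v = 0)"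

definition multilinear :: "nat \<Rightarrow> ('v::real_vector list \<Rightarrow> real) \<Rightarrow> bool" where
  "multilinear r T \<longleftrightarrow> (\<forall>vs s. length vs = r \<and> s < r \<longrightarrow> linear (\<lambda>v. T (vs[s := v])))"

text \<open>The vector \<open>r\<close> with \<open>B(r, y) = A\<^sup>j(u, v, x, y; zs)\<close> for all \<open>y\<close>, \<open>j = length zs\<close>; this is
  \<open>(\<nabla>\<^sup>jR)(u, v; zs) x\<close> with \<open>\<nabla>\<^sup>jR\<close> viewed as endomorphism valued.\<close>

definition model_endo ::
  "('v::euclidean_space \<Rightarrow> 'v \<Rightarrow> real) \<Rightarrow> (nat \<Rightarrow> 'v list \<Rightarrow> real) \<Rightarrow> 'v \<Rightarrow> 'v \<Rightarrow> 'v list \<Rightarrow> 'v \<Rightarrow> 'v" where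
  "model_endo B A u v zs x = (THE r. \<forall>y. B r y = A (length zs) ([u, v, x, y] @ zs))"

text \<open>The universal algebraic identities of \<open>R, \<nabla>R, \<dots>, \<nabla>\<^sup>kR\<close>: the symmetries of the curvature
  tensor and the first Bianchi identity in the first four arguments, the second Bianchi identity,
  and the Ricci identities. The latter say that
  \<open>\<nabla>\<^bsup>p+2\<^esup>R(ys; u, v) - \<nabla>\<^bsup>p+2\<^esup>R(ys; v, u)\<close> is the sum of the \<open>\<nabla>\<^sup>pR(\<dots>, R(u, v) ys\<^sub>s, \<dots>)\<close>;
  differentiating further in the directions \<open>zs\<close> gives, by the Leibniz rule, a sum over the sets
  \<open>S\<close> of those directions in which the factor \<open>R(u, v)\<close> is differentiated.\<close>

definition curvature_identities ::
  "nat \<Rightarrow> ('v::euclidean_space \<Rightarrow> 'v \<Rightarrow> real) \<Rightarrow> (nat \<Rightarrow> 'v list \<Rightarrow> real) \<Rightarrow> bool" where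
  "curvature_identities k B A \<longleftrightarrow>
     (\<forall>i\<le>k. \<forall>x y z w zs. length zs = i \<longrightarrow>
        A i ([x, y, z, w] @ zs) = - A i ([y, x, z, w] @ zs) \<and>
        A i ([x, y, z, w] @ zs) = A i ([z, w, x, y] @ zs) \<and>
        A i ([x, y, z, w] @ zs) + A i ([y, z, x, w] @ zs) + A i ([z, x, y, w] @ zs) = 0) \<and>
     (\<forall>i\<le>k. \<forall>x y z w u zs. Suc (length zs) = i \<longrightarrow>
        A i ([x, y, z, w, u] @ zs) + A i ([y, u, z, w, x] @ zs) + A i ([u, x, z, w, y] @ zs) = 0) \<and>
     (\<forall>i\<le>k. \<forall>p ys u v zs. length ys = 4 + p \<and> p + 2 + length zs = i \<longrightarrow>
        A i (ys @ [u, v] @ zs) - A i (ys @ [v, u] @ zs) =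
          (\<Sum>S\<in>Pow {..<length zs}. \<Sum>s<length ys.
             A (p + (length zs - card S))
               (ys[s := model_endo B A u v (nths zs S) (ys ! s)] @ nths zs (- S))))"

definition curvature_model ::
  "nat \<Rightarrow> ('v::euclidean_space \<Rightarrow> 'v \<Rightarrow> real) \<Rightarrow> (nat \<Rightarrow> 'v list \<Rightarrow> real) \<Rightarrow> bool" where
  "curvature_model k B A \<longleftrightarrow>
     nondegenerate_inner_product B \<and> (\<forall>i\<le>k. multilinear (4 + i) (A i)) \<and>
     curvature_identities k B A"

section \<open>Curvature homogeneity\<close>

text \<open>The tangent space at \<open>P\<close> is \<open>real^'n\<close> by means of a chart \<open>c\<close> around \<open>P\<close>. Below, all
  charts \<open>c\<close> and all \<open>P \<in> fst c\<close> are considered, i.e. all points and all descriptions of their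
  tangent spaces.\<close>

definition tangent_isometry ::
  "('a, 'n::finite) pr_manifold \<Rightarrow> ('a, 'n) chart \<Rightarrow> 'a \<Rightarrow> ('v::euclidean_space \<Rightarrow> 'v \<Rightarrow> real) \<Rightarrow>
     (real^'n \<Rightarrow> 'v) \<Rightarrow> bool" where
  "tangent_isometry M c P B \<phi> \<longleftrightarrow> linear \<phi> \<and> bij \<phi> \<and>
     (\<forall>v w. B (\<phi> v) (\<phi> w) = metric_form (metric M c) (snd c P) v w)"

text \<open>\<open>\<phi>\<^sup>* A\<^sup>l = t \<nabla>\<^sup>lR\<^sub>P\<close>\<close>

definition pulls_back_to ::
  "('a, 'n::finite) pr_manifold \<Rightarrow> ('a, 'n) chart \<Rightarrow> 'a \<Rightarrow> (nat \<Rightarrow> 'v list \<Rightarrow> real) \<Rightarrow> nat \<Rightarrow>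
     (real^'n \<Rightarrow> 'v) \<Rightarrow> real \<Rightarrow> bool" where
  "pulls_back_to M c P A l \<phi> t \<longleftrightarrow> (\<forall>vs. length vs = 4 + l \<longrightarrow>
     A l (map \<phi> vs) = t * nabla_curv (metric M c) l (snd c P) vs)"

definition curv_hom_model ::
  "nat \<Rightarrow> ('a, 'n::finite) pr_manifold \<Rightarrow> ('v::euclidean_space \<Rightarrow> 'v \<Rightarrow> real) \<Rightarrow>
     (nat \<Rightarrow> 'v list \<Rightarrow> real) \<Rightarrow> bool" where
  "curv_hom_model k M B A \<longleftrightarrow> (\<forall>c\<in>atlas M. \<forall>P\<in>fst c.
     \<exists>\<phi>. tangent_isometry M c P B \<phi> \<and> (\<forall>l\<le>k. pulls_back_to M c P A l \<phi> 1))"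

definition homothety_curv_hom_model ::
  "nat \<Rightarrow> ('a, 'n::finite) pr_manifold \<Rightarrow> ('v::euclidean_space \<Rightarrow> 'v \<Rightarrow> real) \<Rightarrow>
     (nat \<Rightarrow> 'v list \<Rightarrow> real) \<Rightarrow> bool" where
  "homothety_curv_hom_model k M B A \<longleftrightarrow> (\<forall>c\<in>atlas M. \<forall>P\<in>fst c.
     \<exists>\<phi> \<mu>. tangent_isometry M c P B \<phi> \<and> \<mu> \<noteq> 0 \<and>
       (\<forall>l\<le>k. pulls_back_to M c P A l \<phi> (\<mu> ^ (2 + l))))"

definition variable_curv_hom_model ::
  "nat \<Rightarrow> ('a, 'n::finite) pr_manifold \<Rightarrow> ('v::euclidean_space \<Rightarrow> 'v \<Rightarrow> real) \<Rightarrow>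
     (nat \<Rightarrow> 'v list \<Rightarrow> real) \<Rightarrow> bool" where
  "variable_curv_hom_model k M B A \<longleftrightarrow> (\<forall>c\<in>atlas M. \<forall>P\<in>fst c. \<forall>l\<le>k.
     \<exists>\<phi>. tangent_isometry M c P B \<phi> \<and> pulls_back_to M c P A l \<phi> 1)"

definition variable_homothety_curv_hom_model ::
  "nat \<Rightarrow> ('a, 'n::finite) pr_manifold \<Rightarrow> ('v::euclidean_space \<Rightarrow> 'v \<Rightarrow> real) \<Rightarrow>
     (nat \<Rightarrow> 'v list \<Rightarrow> real) \<Rightarrow> bool" where
  "variable_homothety_curv_hom_model k M B A \<longleftrightarrow> (\<forall>c\<in>atlas M. \<forall>P\<in>fst c. \<forall>l\<le>k.
     \<exists>\<phi> \<mu>. tangent_isometry M c P B \<phi> \<and> \<mu> \<noteq> 0 \<and> pulls_back_to M c P A l \<phi> (\<mu> ^ (2 + l)))"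

text \<open>The properties without a model. As the vector space of a model of a nonempty manifold \<open>M\<close> is
  isometric to the tangent spaces of \<open>M\<close>, it may be taken to be \<open>real^'n\<close> (with an arbitrary
  inner product \<open>B\<close>).\<close>

definition curv_hom :: "nat \<Rightarrow> ('a, 'n::finite) pr_manifold \<Rightarrow> bool" where
  "curv_hom k M \<longleftrightarrow>
     (\<exists>(B :: real^'n \<Rightarrow> real^'n \<Rightarrow> real) A. curvature_model k B A \<and> curv_hom_model k M B A)"

definition homothety_curv_hom :: "nat \<Rightarrow> ('a, 'n::finite) pr_manifold \<Rightarrow> bool" where
  "homothety_curv_hom k M \<longleftrightarrow>
     (\<exists>(B :: real^'n \<Rightarrow> real^'n \<Rightarrow> real) A.
        curvature_model k B A \<and> homothety_curv_hom_model k M B A)"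

definition variable_curv_hom :: "nat \<Rightarrow> ('a, 'n::finite) pr_manifold \<Rightarrow> bool" where
  "variable_curv_hom k M \<longleftrightarrow>
     (\<exists>(B :: real^'n \<Rightarrow> real^'n \<Rightarrow> real) A.
        curvature_model k B A \<and> variable_curv_hom_model k M B A)"

definition variable_homothety_curv_hom :: "nat \<Rightarrow> ('a, 'n::finite) pr_manifold \<Rightarrow> bool" where
  "variable_homothety_curv_hom k M \<longleftrightarrow>
     (\<exists>(B :: real^'n \<Rightarrow> real^'n \<Rightarrow> real) A.
        curvature_model k B A \<and> variable_homothety_curv_hom_model k M B A)"

end

theory Submission
  imports Defs
begin

text \<open>
  For \<open>f = h(x) y\<^sup>2 / 2\<close> the one-form \<open>dx\<close> and the two-form \<open>dx \<and> dy\<close> are parallel, so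
  \<open>\<nabla>\<^sup>lR\<close> is \<open>- h\<^sup>(\<^sup>l\<^sup>)(x)\<close> times the constant tensor \<open>(dx \<and> dy)\<^sup>2 dx\<^sup>l\<close>. A linear isometry
  scales this tensor by an arbitrary \<open>a\<^bsup>2+l\<^esup>\<close>, hence at each separate level only the vanishing and the
  sign of \<open>h\<^sup>(\<^sup>l\<^sup>)\<close> matter. With \<open>h = exp x - exp (2 x)\<close> on a suitable half space the first zero occurs at
  level \<open>k + 1\<close>. With \<open>h = exp x\<close> all levels can be normalized separately, but a common \<open>a\<close> and a
  common homothety factor for the levels 0 and 1 force \<open>h\<close> to be constant.

  The metric \<open>2 (u + v)\<^sup>2 du dv + dz\<^sup>2\<close> on \<open>u + v > 0\<close> has homotheties acting transitively on the values
  of \<open>u + v\<close>, and its scalar curvature is not constant. It is therefore homothety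
  curvature homogeneous of every order, but not even variable \<open>0\<close>-curvature homogeneous.\<close>

section \<open>Smooth functions\<close>

text \<open>A model must satisfy the Ricci identities with all their Leibniz expansions. They are
  verified algebraically rather than inherited from a point of a manifold. Tensors of the form
  squared area form times \<open>P\<close> make this feasible, since every identity then reduces to
  one about \<open>P\<close>. For the waves that identity is trivial; for the cone metric it is the
  main labour. A second metric is unavoidable: on a wave a homothety factor can be absorbed into a
  boost at each level, so homothety homogeneity would imply the variable kind. A metric with a
  nonconstant scalar invariant is required. The exponent is chosen as follows: the curvature tensor
  of 2 s^a du dv with s = u + v is a s^(a-2) times the squared area form, so a = 2 makes it constant
  in coordinates. The term dz^2 only raises the dimension to three. Failure of local homogeneity is
  not deduced from level 1, which would need the invariance of the covariant derivatives of R under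
  isometries. Derivatives of a local isometry up to third order are compared in coordinates instead,
  and the coordinate x turns out to be preserved.\<close>

lemma dir_deriv_eq: "(f has_derivative f') (at p) \<Longrightarrow> dir_deriv f p v = f' v"
  by (metis frechet_derivative_at)

lemma dir_deriv_cong_open:
  assumes "open S" "p \<in> S" "\<And>q. q \<in> S \<Longrightarrow> f q = g q"
  shows "dir_deriv f p v = dir_deriv g p v"
proof -
  have "(f has_derivative f') (at p) \<longleftrightarrow> (g has_derivative f') (at p)" for f'
    using has_derivative_transform_within_open[of f f' p UNIV S g]
      has_derivative_transform_within_open[of g f' p UNIV S f] assms by auto
  then show ?thesis by (simp add: frechet_derivative_def)
qed

lemma iter_deriv_cong_open:
  assumes "open S" "\<And>q. q \<in> S \<Longrightarrow> f q = g q" "p \<in> S"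
  shows "iter_deriv vs f p = iter_deriv vs g p"
  using assms
proof (induction vs arbitrary: f g)
  case (Cons v vs)
  show ?case
    unfolding iter_deriv.simps
    by (rule Cons.IH) (use Cons.prems dir_deriv_cong_open[of S _ f g v] in auto)
qed auto

text \<open>Coordinate representations contain \<open>inv_into\<close>, whose values off the domain
  are arbitrary, so smoothness has to be transported along equality on the open set alone.\<close>

lemma smooth_on_cong:
  assumes "open S" "\<And>q. q \<in> S \<Longrightarrow> f q = g q" "smooth_on S f"
  shows "smooth_on S g"
  unfolding smooth_on_def
proof (intro allI ballI)
  fix vs p assume p: "p \<in> S"
  then have "iter_deriv vs f differentiable at p"
    using assms(3) by (auto simp: smooth_on_def)
  then obtain f' where "(iter_deriv vs f has_derivative f') (at p)"
    unfolding differentiable_def by blast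
  then have "(iter_deriv vs g has_derivative f') (at p)"
    by (rule has_derivative_transform_within_open[OF _ assms(1) p])
      (rule iter_deriv_cong_open[OF assms(1,2)])
  then show "iter_deriv vs g differentiable at p"
    unfolding differentiable_def by blast
qed

text \<open>\<open>iter_deriv\<close> first differentiates along the head of the list, so a class
  closed under one directional derivative contains all iterates. No formula for higher derivatives
  is ever needed.\<close>

lemma smooth_on_coinduct:
  assumes "C f" and "\<And>f p. C f \<Longrightarrow> p \<in> S \<Longrightarrow> f differentiable at p"
    and "\<And>f v. C f \<Longrightarrow> C (\<lambda>p. dir_deriv f p v)"
  shows "smooth_on S f"
proof -
  have "C (iter_deriv vs f)" for vs
    using assms(1) by (induction vs arbitrary: f) (auto intro: assms(3))
  then show ?thesis
    unfolding smooth_on_def using assms(2) by blast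
qed

lemma smooth_on_differentiable: "smooth_on S f \<Longrightarrow> p \<in> S \<Longrightarrow> f differentiable (at p)"
  unfolding smooth_on_def by (metis iter_deriv.simps(1))

lemma smooth_on_dir_deriv: "smooth_on S f \<Longrightarrow> smooth_on S (\<lambda>p. dir_deriv f p v)"
  unfolding smooth_on_def by (metis iter_deriv.simps(2))

lemma smooth_on_bounded_linear:
  assumes "bounded_linear f"
  shows "smooth_on S f"
proof (rule smooth_on_coinduct[where C = "\<lambda>g. bounded_linear g \<or> (\<exists>c. g = (\<lambda>p. c))"])
  fix g :: "'a \<Rightarrow> 'b" and p v
  assume g: "bounded_linear g \<or> (\<exists>c. g = (\<lambda>p. c))"
  then show "g differentiable at p"
    by (auto intro: bounded_linear_imp_differentiable)
  have "dir_deriv g p v = (if bounded_linear g then g v else 0)" for p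
    using g dir_deriv_eq[OF bounded_linear_imp_has_derivative, of g p v]
      dir_deriv_eq[OF has_derivative_const, of _ p v] by auto
  then show "bounded_linear (\<lambda>p. dir_deriv g p v) \<or> (\<exists>c. (\<lambda>p. dir_deriv g p v) = (\<lambda>p. c))"
    by auto
qed (use assms in auto)

text \<open>The metric coefficients of all examples lie in this class. Its closure under directional
  derivatives takes the place of general closure theorems for smooth functions.\<close>

inductive elementary :: "('a::real_normed_vector \<Rightarrow> real) \<Rightarrow> bool" where
  const: "elementary (\<lambda>p. c)"
| linear: "bounded_linear f \<Longrightarrow> elementary f"
| add: "elementary f \<Longrightarrow> elementary g \<Longrightarrow> elementary (\<lambda>p. f p + g p)"
| mult: "elementary f \<Longrightarrow> elementary g \<Longrightarrow> elementary (\<lambda>p. f p * g p)"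
| exp: "elementary f \<Longrightarrow> elementary (\<lambda>p. exp (f p))"

lemma elementary_deriv:
  "elementary f \<Longrightarrow> \<exists>f'. (\<forall>p. (f has_derivative f' p) (at p)) \<and> (\<forall>v. elementary (\<lambda>p. f' p v))"
proof (induction rule: elementary.induct)
  case (const c)
  show ?case
    by (intro exI[of _ "\<lambda>p v. 0"]) (auto intro: elementary.intros)
next
  case (linear f)
  then show ?case
    by (intro exI[of _ "\<lambda>p v. f v"])
      (auto intro: elementary.intros bounded_linear_imp_has_derivative)
next
  case (add f g)
  then obtain f' g' where "\<forall>p. (f has_derivative f' p) (at p)" "\<forall>p. (g has_derivative g' p) (at p)"
    "\<forall>v. elementary (\<lambda>p. f' p v)" "\<forall>v. elementary (\<lambda>p. g' p v)" by blast
  then show ?case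
    by (intro exI[of _ "\<lambda>p v. f' p v + g' p v"])
      (auto intro: elementary.intros has_derivative_add)
next
  case (mult f g)
  then obtain f' g' where "\<forall>p. (f has_derivative f' p) (at p)" "\<forall>p. (g has_derivative g' p) (at p)"
    "\<forall>v. elementary (\<lambda>p. f' p v)" "\<forall>v. elementary (\<lambda>p. g' p v)" by blast
  with mult.hyps show ?case
    by (intro exI[of _ "\<lambda>p v. f p * g' p v + f' p v * g p"])
      (auto intro!: elementary.add elementary.mult has_derivative_mult)
next
  case (exp f)
  then obtain f' where "\<forall>p. (f has_derivative f' p) (at p)" "\<forall>v. elementary (\<lambda>p. f' p v)"
    by blast
  with exp.hyps show ?case
    by (intro exI[of _ "\<lambda>p v. exp (f p) * f' p v"])
      (auto intro!: elementary.mult elementary.exp derivative_eq_intros)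
qed

lemma elementary_dir_deriv:
  assumes "elementary f"
  shows "f differentiable (at p)" "elementary (\<lambda>p. dir_deriv f p v)"
proof -
  obtain f' where f': "\<forall>p. (f has_derivative f' p) (at p)" "\<forall>v. elementary (\<lambda>p. f' p v)"
    using elementary_deriv[OF assms] by blast
  show "f differentiable (at p)"
    using f' by (auto simp: differentiable_def)
  have "(\<lambda>p. dir_deriv f p v) = (\<lambda>p. f' p v)"
    using f' dir_deriv_eq by blast
  then show "elementary (\<lambda>p. dir_deriv f p v)"
    using f' by simp
qed

lemma elementary_smooth_on: "elementary f \<Longrightarrow> smooth_on S f"
  by (rule smooth_on_coinduct[where C = elementary]) (auto intro: elementary_dir_deriv)

lemma has_derivative_matrix:
  fixes g :: "'a::real_normed_vector \<Rightarrow> real^'n^'m"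
  assumes "\<And>i j. ((\<lambda>p. g p $ i $ j) has_derivative (\<lambda>v. g' v $ i $ j)) (at p)"
  shows "(g has_derivative g') (at p)"
  using assms
  by (subst has_derivative_componentwise_within)
    (auto simp: Basis_vec_def inner_axis)

lemma matrix_elementary_smooth_on:
  fixes g :: "'a::real_normed_vector \<Rightarrow> real^'n^'m"
  assumes "\<And>i j. elementary (\<lambda>p. g p $ i $ j)"
  shows "smooth_on S g"
proof (rule smooth_on_coinduct[where C = "\<lambda>g. \<forall>i j. elementary (\<lambda>p. g p $ i $ j)"])
  fix h :: "'a \<Rightarrow> real^'n^'m"
  assume h: "\<forall>i j. elementary (\<lambda>p. h p $ i $ j)"
  have D: "(h has_derivative (\<lambda>v. \<chi> i j. dir_deriv (\<lambda>q. h q $ i $ j) p v)) (at p)" for p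
  proof (rule has_derivative_matrix)
    fix i j
    have "((\<lambda>q. h q $ i $ j) has_derivative dir_deriv (\<lambda>q. h q $ i $ j) p) (at p)"
      using h elementary_dir_deriv(1) frechet_derivative_works by blast
    then show "((\<lambda>q. h q $ i $ j) has_derivative
        (\<lambda>v. (\<chi> i j. dir_deriv (\<lambda>q. h q $ i $ j) p v) $ i $ j)) (at p)"
      by simp
  qed
  then show "h differentiable at p" for p
    by (auto simp: differentiable_def)
  show "\<forall>i j. elementary (\<lambda>p. dir_deriv h p v $ i $ j)" for v
    using h by (auto simp: dir_deriv_eq[OF D] intro: elementary_dir_deriv(2))
qed (use assms in auto)

text \<open>Symmetry of second derivatives in Peano's form, which needs no continuity of the second
  derivatives: both equal the limit of the second difference quotient.\<close>

lemma second_difference_estimate: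
  fixes F :: "'a::real_normed_vector \<Rightarrow> real"
  assumes S: "open S" "p \<in> S" and F: "\<And>q. q \<in> S \<Longrightarrow> F differentiable (at q)"
    and L: "((\<lambda>q. dir_deriv F q u) has_derivative L) (at p)" and e: "e > 0"
  shows "\<exists>d>0. \<forall>h. 0 < h \<and> h < d \<longrightarrow>
    \<bar>F (p + h *\<^sub>R u + h *\<^sub>R v) - F (p + h *\<^sub>R u) - F (p + h *\<^sub>R v) + F p - h\<^sup>2 * L v\<bar> \<le> e * h\<^sup>2"
proof -
  \<comment> \<open>\<open>h * N\<close> bounds the displacements that occur; the summand 1 keeps
    \<open>N\<close> positive when both directions vanish.\<close>
  define N where "N = norm u + norm v + 1"
  have N: "N > 0" "norm u \<le> N" "norm v \<le> N" "norm u + norm v < N"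
    by (auto simp: N_def intro: add_nonneg_pos)
  define e' where "e' = e / (2 * N)"
  have e': "e' > 0" using e N by (simp add: e'_def)
  obtain r where r: "r > 0" "ball p r \<subseteq> S"
    using S openE by blast
  obtain d where d: "d > 0"
    "\<And>y. norm (y - p) < d \<Longrightarrow>
      norm (dir_deriv F y u - dir_deriv F p u - L (y - p)) \<le> e' * norm (y - p)"
    using L e' unfolding has_derivative_at_alt by blast
  have lin: "linear L" using L has_derivative_linear by blast
  show ?thesis
  proof (intro exI conjI allI impI)
    show "min r d / N > 0" using r d N by simp
    fix h :: real assume h: "0 < h \<and> h < min r d / N"
    then have hN: "h * N < r" "h * N < d" using N
      by (auto simp: field_simps)
    have small: "norm (s *\<^sub>R u + t *\<^sub>R v) \<le> h * N" if "0 \<le> s" "s \<le> h" "0 \<le> t" "t \<le> h" for s t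
    proof -
      have "norm (s *\<^sub>R u + t *\<^sub>R v) \<le> s * norm u + t * norm v"
        using that norm_triangle_ineq[of "s *\<^sub>R u" "t *\<^sub>R v"] by simp
      also have "\<dots> \<le> h * norm u + h * norm v"
        using that by (intro add_mono mult_right_mono) auto
      also have "\<dots> \<le> h * N"
        using h by (simp add: N_def algebra_simps)
      finally show ?thesis .
    qed
    have inS: "p + s *\<^sub>R u + t *\<^sub>R v \<in> S" if "0 \<le> s" "s \<le> h" "0 \<le> t" "t \<le> h" for s t
    proof -
      have "dist p (p + s *\<^sub>R u + t *\<^sub>R v) < r"
        using small[OF that] hN by (simp add: dist_norm norm_minus_commute algebra_simps)
      then show ?thesis using r by auto
    qed
    \<comment> \<open>The second difference is the increment of \<open>g\<close> from 0 to
      \<open>h\<close>. The mean value theorem turns it into a difference of two first derivatives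
      along \<open>u\<close>, both of which \<open>L\<close> approximates.\<close>
    define g where "g s = F (p + s *\<^sub>R u + h *\<^sub>R v) - F (p + s *\<^sub>R u)" for s
    have der: "((\<lambda>s. F (p + s *\<^sub>R u + t *\<^sub>R v)) has_real_derivative
        dir_deriv F (p + s *\<^sub>R u + t *\<^sub>R v) u) (at s)"
      if "0 \<le> s" "s \<le> h" "0 \<le> t" "t \<le> h" for s t
    proof -
      have "(F has_derivative frechet_derivative F (at (p + s *\<^sub>R u + t *\<^sub>R v)))
          (at (p + s *\<^sub>R u + t *\<^sub>R v))"
        using F inS[OF that] frechet_derivative_works by blast
      moreover have "((\<lambda>s. p + s *\<^sub>R u + t *\<^sub>R v) has_derivative (\<lambda>s. s *\<^sub>R u)) (at s)"
        by (auto intro!: derivative_eq_intros)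
      ultimately have "((\<lambda>s. F (p + s *\<^sub>R u + t *\<^sub>R v)) has_derivative
          (\<lambda>x. dir_deriv F (p + s *\<^sub>R u + t *\<^sub>R v) (x *\<^sub>R u))) (at s)"
        by (rule has_derivative_compose[rotated])
      moreover have "linear (frechet_derivative F (at (p + s *\<^sub>R u + t *\<^sub>R v)))"
        using F inS[OF that] linear_frechet_derivative by blast
      ultimately show ?thesis
        by (simp add: has_field_derivative_def linear_scale mult.commute[of _ "dir_deriv F _ u"])
    qed
    have "\<exists>\<xi>>0. \<xi> < h \<and> g h - g 0 =
        (h - 0) * (dir_deriv F (p + \<xi> *\<^sub>R u + h *\<^sub>R v) u - dir_deriv F (p + \<xi> *\<^sub>R u) u)"
    proof (rule MVT2)
      show "0 < h" using h by simp
      fix s assume s: "0 \<le> s" "s \<le> h"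
      show "(g has_real_derivative
          dir_deriv F (p + s *\<^sub>R u + h *\<^sub>R v) u - dir_deriv F (p + s *\<^sub>R u) u) (at s)"
        unfolding g_def using der[of s h] der[of s 0] s h
        by (intro DERIV_diff) auto
    qed
    then obtain \<xi> where \<xi>: "0 < \<xi>" "\<xi> < h" "g h - g 0 =
        h * (dir_deriv F (p + \<xi> *\<^sub>R u + h *\<^sub>R v) u - dir_deriv F (p + \<xi> *\<^sub>R u) u)" by auto
    have est: "\<bar>dir_deriv F (p + \<xi> *\<^sub>R u + t *\<^sub>R v) u - dir_deriv F p u - L (\<xi> *\<^sub>R u + t *\<^sub>R v)\<bar>
        \<le> e' * (h * N)" if "0 \<le> t" "t \<le> h" for t
    proof -
      have "norm (\<xi> *\<^sub>R u + t *\<^sub>R v) \<le> h * N" using small \<xi> that by simp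
      moreover have "\<bar>dir_deriv F (p + \<xi> *\<^sub>R u + t *\<^sub>R v) u - dir_deriv F p u - L (\<xi> *\<^sub>R u + t *\<^sub>R v)\<bar>
          \<le> e' * norm (\<xi> *\<^sub>R u + t *\<^sub>R v)"
        using d(2)[of "p + \<xi> *\<^sub>R u + t *\<^sub>R v"] calculation hN by (simp add: add.assoc)
      ultimately show ?thesis
        using e' mult_left_mono[of "norm (\<xi> *\<^sub>R u + t *\<^sub>R v)" "h * N" e'] by linarith
    qed
    have "g h - g 0 - h\<^sup>2 * L v = h *
        ((dir_deriv F (p + \<xi> *\<^sub>R u + h *\<^sub>R v) u - dir_deriv F p u - L (\<xi> *\<^sub>R u + h *\<^sub>R v))
        - (dir_deriv F (p + \<xi> *\<^sub>R u + 0 *\<^sub>R v) u - dir_deriv F p u - L (\<xi> *\<^sub>R u + 0 *\<^sub>R v)))"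
      using \<xi>(3) lin by (simp add: linear_add linear_scale algebra_simps power2_eq_square)
    then have "\<bar>g h - g 0 - h\<^sup>2 * L v\<bar> = h *
        \<bar>(dir_deriv F (p + \<xi> *\<^sub>R u + h *\<^sub>R v) u - dir_deriv F p u - L (\<xi> *\<^sub>R u + h *\<^sub>R v))
        - (dir_deriv F (p + \<xi> *\<^sub>R u + 0 *\<^sub>R v) u - dir_deriv F p u - L (\<xi> *\<^sub>R u + 0 *\<^sub>R v))\<bar>"
      using h by (simp add: abs_mult)
    also have "\<dots> \<le> h * (e' * (h * N) + e' * (h * N))"
      using est[of h] est[of 0] h by (intro mult_left_mono) linarith+
    also have "\<dots> = e * h\<^sup>2"
      using N by (simp add: e'_def field_simps power2_eq_square)
    finally show "\<bar>F (p + h *\<^sub>R u + h *\<^sub>R v) - F (p + h *\<^sub>R u) - F (p + h *\<^sub>R v) + F p - h\<^sup>2 * L v\<bar>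
        \<le> e * h\<^sup>2"
      by (simp add: g_def algebra_simps)
  qed
qed

lemma dir_deriv_commute:
  fixes F :: "'a::real_normed_vector \<Rightarrow> real"
  assumes S: "open S" "p \<in> S" and F: "\<And>q. q \<in> S \<Longrightarrow> F differentiable (at q)"
    and u: "(\<lambda>q. dir_deriv F q u) differentiable (at p)"
    and v: "(\<lambda>q. dir_deriv F q v) differentiable (at p)"
  shows "dir_deriv (\<lambda>q. dir_deriv F q u) p v = dir_deriv (\<lambda>q. dir_deriv F q v) p u"
    (is "?a = ?b")
proof -
  have "\<bar>?a - ?b\<bar> \<le> 2 * e" if e: "e > 0" for e
  proof -
    obtain d1 where d1: "d1 > 0" "\<And>h. 0 < h \<and> h < d1 \<Longrightarrow>
      \<bar>F (p + h *\<^sub>R u + h *\<^sub>R v) - F (p + h *\<^sub>R u) - F (p + h *\<^sub>R v) + F p - h\<^sup>2 * ?a\<bar> \<le> e * h\<^sup>2"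
      using second_difference_estimate[OF S F u[unfolded frechet_derivative_works] e, of v] by blast
    obtain d2 where d2: "d2 > 0" "\<And>h. 0 < h \<and> h < d2 \<Longrightarrow>
      \<bar>F (p + h *\<^sub>R v + h *\<^sub>R u) - F (p + h *\<^sub>R v) - F (p + h *\<^sub>R u) + F p - h\<^sup>2 * ?b\<bar> \<le> e * h\<^sup>2"
      using second_difference_estimate[OF S F v[unfolded frechet_derivative_works] e, of u] by blast
    define h where "h = min d1 d2 / 2"
    have h: "0 < h" "h < d1" "h < d2" using d1(1) d2(1) by (auto simp: h_def)
    have *: "p + h *\<^sub>R v + h *\<^sub>R u = p + h *\<^sub>R u + h *\<^sub>R v" by simp
    have "\<bar>h\<^sup>2 * ?a - h\<^sup>2 * ?b\<bar> \<le> 2 * (e * h\<^sup>2)"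
      using d1(2)[OF conjI[OF h(1,2)]] d2(2)[OF conjI[OF h(1,3)]] unfolding * by linarith
    then have "h\<^sup>2 * \<bar>?a - ?b\<bar> \<le> h\<^sup>2 * (2 * e)"
      by (simp only: abs_mult mult_ac flip: right_diff_distrib) simp
    then show ?thesis using h by simp
  qed
  \<comment> \<open>With this choice the gap is at most half of itself.\<close>
  from this[of "\<bar>?a - ?b\<bar> / 4"] show ?thesis by (cases "?a = ?b") auto
qed

section \<open>Curvature models carried by a plane\<close>

definition area :: "real^3 \<Rightarrow> real^3 \<Rightarrow> real" where
  "area x y = x $ 1 * y $ 2 - x $ 2 * y $ 1"

text \<open>\<open>P\<close> accepts lists of every length, so that one function describes the
  tensors of a model at all levels.\<close>

definition area_tensor :: "((real^3) list \<Rightarrow> real) \<Rightarrow> (real^3) list \<Rightarrow> real" where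
  "area_tensor P vs = area (vs ! 0) (vs ! 1) * area (vs ! 2) (vs ! 3) * P (drop 4 vs)"

lemma area_linear:
  "area (x + y) z = area x z + area y z" "area z (x + y) = area z x + area z y"
  "area (c *\<^sub>R x) z = c * area x z" "area z (c *\<^sub>R x) = c * area z x"
  by (simp_all add: area_def algebra_simps)

lemma area_tensor_Cons4 [simp]:
  "area_tensor P ([x, y, z, w] @ zs) = area x y * area z w * P zs"
  "area_tensor P (x # y # z # w # zs) = area x y * area z w * P zs"
  by (simp_all add: area_tensor_def)

lemma multilinear_area_tensor:
  assumes "multilinear r P"
  shows "multilinear (4 + r) (area_tensor P)"
  unfolding multilinear_def
proof (intro allI impI)
  fix vs :: "(real^3) list" and s
  assume vs: "length vs = 4 + r \<and> s < 4 + r"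
  show "linear (\<lambda>v. area_tensor P (vs[s := v]))"
  proof (cases "s < 4")
    case True
    then consider "s = 0" | "s = 1" | "s = 2" | "s = 3" by linarith
    then show ?thesis
      using vs True by cases (auto intro!: linearI simp: area_tensor_def area_linear algebra_simps)
  next
    case False
    then have "linear (\<lambda>v. P ((drop 4 vs)[s - 4 := v]))"
      using assms vs by (auto simp: multilinear_def)
    note lin = linear_add[OF this] linear_scale[OF this]
    show ?thesis
      using False by (auto intro!: linearI simp: area_tensor_def drop_update_swap lin algebra_simps)
  qed
qed

lemma multilinear_update:
  assumes "multilinear r T" "length vs = r" "s < r"
  shows "T (vs[s := x + y]) = T (vs[s := x]) + T (vs[s := y])"
    and "T (vs[s := x - y]) = T (vs[s := x]) - T (vs[s := y])"
    and "T (vs[s := c *\<^sub>R x]) = c * T (vs[s := x])"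
    and "T (vs[s := 0]) = 0"
proof -
  have "linear (\<lambda>v. T (vs[s := v]))" using assms by (auto simp: multilinear_def)
  from linear_add[OF this] linear_diff[OF this] linear_scale[OF this] linear_0[OF this] show
    "T (vs[s := x + y]) = T (vs[s := x]) + T (vs[s := y])"
    "T (vs[s := x - y]) = T (vs[s := x]) - T (vs[s := y])"
    "T (vs[s := c *\<^sub>R x]) = c * T (vs[s := x])"
    "T (vs[s := 0]) = 0" by auto
qed

lemma sum_lessThan_add: "(\<Sum>s<m + n. f s) = (\<Sum>s<m. f s) + (\<Sum>s<n. f (m + s))"
  for f :: "nat \<Rightarrow> real"
  by (induction n) auto

lemma list_4_append:
  assumes "length ys = 4 + p"
  obtains x y z w ys' where "ys = [x, y, z, w] @ ys'" "length ys' = p"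
proof -
  obtain x y z w ys' where "ys = x # y # z # w # ys'"
    using assms by (auto simp: numeral_eq_Suc length_Suc_conv)
  then show ?thesis using that assms by simp
qed

text \<open>Leibniz rule: \<open>N\<close> multiplies each of the two area factors by its trace
  \<tau> on the plane and acts on the remaining slots through \<open>P\<close>. It is applied to
  Christoffel endomorphisms and to the curvature endomorphism; for the latter, \<open>zs\<close>
  holds the slots that are not acted on.\<close>

lemma area_tensor_derivation:
  assumes N: "\<And>x y. area (N x) y + area x (N y) = \<tau> * area x y"
  shows "(\<Sum>s<4 + length ys. area_tensor P (([x, y, z, w] @ ys)[s := N (([x, y, z, w] @ ys) ! s)] @ zs))
    = area x y * area z w * (2 * \<tau> * P (ys @ zs) + (\<Sum>s<length ys. P (ys[s := N (ys ! s)] @ zs)))"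
proof -
  have "(\<Sum>s<4. area_tensor P (([x, y, z, w] @ ys)[s := N (([x, y, z, w] @ ys) ! s)] @ zs))
    = ((area (N x) y + area x (N y)) * area z w
      + area x y * (area (N z) w + area z (N w))) * P (ys @ zs)"
    by (simp add: lessThan_nat_numeral lessThan_Suc numeral_eq_Suc algebra_simps)
  also have "\<dots> = area x y * area z w * (2 * \<tau> * P (ys @ zs))"
    unfolding N by (simp add: algebra_simps)
  finally show ?thesis
    by (simp add: sum_lessThan_add sum_distrib_left distrib_left)
qed

lemma model_endo_eqI:
  assumes "nondegenerate_inner_product B" "\<And>y. B r y = A (length zs) ([u, v, x, y] @ zs)"
  shows "model_endo B A u v zs x = r"
  unfolding model_endo_def
proof (rule the_equality)
  fix r' assume r': "\<forall>y. B r' y = A (length zs) ([u, v, x, y] @ zs)"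
  have "bilinear B" using assms(1) by (simp add: nondegenerate_inner_product_def)
  then have "B (r' - r) y = 0" for y
    using assms(2) r' by (simp add: bilinear_lsub)
  then show "r' = r"
    using assms(1) unfolding nondegenerate_inner_product_def by (metis right_minus_eq)
qed (use assms in auto)

text \<open>\<open>H\<close> is the area form with an index raised by \<open>B\<close>, so every
  curvature endomorphism is a multiple of it. Being trace-free, \<open>H\<close> annihilates the
  area factors, and the Ricci identities collapse to \<open>ricci\<close>. By \<open>plane\<close>,
  the second Bianchi identity concerns the wedge product of the area form with a covector of the
  same plane, a 3-form in two variables.\<close>

lemma curvature_model_area_tensor:
  assumes B: "nondegenerate_inner_product B"
    and H: "\<And>x y. B (H x) y = area x y" "\<And>x y. area (H x) y + area x (H y) = 0"
    and P: "\<And>r. multilinear r P"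
    and plane: "\<And>zs. \<exists>a b. \<forall>u. P (u # zs) = u $ 1 * a + u $ 2 * b"
    and ricci: "\<And>ys u v zs. P (ys @ [u, v] @ zs) - P (ys @ [v, u] @ zs) =
      (\<Sum>S\<in>Pow {..<length zs}. area u v * P (nths zs S) *
        (\<Sum>s<length ys. P (ys[s := H (ys ! s)] @ nths zs (- S))))"
  shows "curvature_model k B (\<lambda>i. area_tensor P)"
proof -
  have endo: "model_endo B (\<lambda>i. area_tensor P) u v zs x = (area u v * P zs) *\<^sub>R H x" for u v zs x
  proof (rule model_endo_eqI[OF B])
    have "bilinear B" using B by (simp add: nondegenerate_inner_product_def)
    then show "B ((area u v * P zs) *\<^sub>R H x) y = area_tensor P ([u, v, x, y] @ zs)" for y
      using H(1) by (simp add: bilinear_lmul)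
  qed
  have bianchi2: "area_tensor P ([x, y, z, w, u] @ zs) + area_tensor P ([y, u, z, w, x] @ zs)
      + area_tensor P ([u, x, z, w, y] @ zs) = 0" for x y z w u zs
  proof -
    obtain a b where "\<And>u. P (u # zs) = u $ 1 * a + u $ 2 * b" using plane by blast
    then show ?thesis by (simp add: area_def algebra_simps)
  qed
  have ricci': "area_tensor P (ys @ [u, v] @ zs) - area_tensor P (ys @ [v, u] @ zs) =
          (\<Sum>S\<in>Pow {..<length zs}. \<Sum>s<length ys. area_tensor P
               (ys[s := model_endo B (\<lambda>i. area_tensor P) u v (nths zs S) (ys ! s)] @ nths zs (- S)))"
    if "length ys = 4 + p" for ys u v zs p
  proof -
    obtain x y z w ys' where ys: "ys = [x, y, z, w] @ ys'" "length ys' = p"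
      using list_4_append \<open>length ys = 4 + p\<close> by blast
    have inner: "(\<Sum>s<length ys. area_tensor P
               (ys[s := model_endo B (\<lambda>i. area_tensor P) u v (nths zs S) (ys ! s)] @ nths zs (- S)))
        = area x y * area z w * (area u v * P (nths zs S) *
          (\<Sum>s<length ys'. P (ys'[s := H (ys' ! s)] @ nths zs (- S))))" for S
    proof -
      define c where "c = area u v * P (nths zs S)"
      have "(\<Sum>s<length ys. area_tensor P (ys[s := c *\<^sub>R H (ys ! s)] @ nths zs (- S)))
        = area x y * area z w * (\<Sum>s<length ys'. P (ys'[s := c *\<^sub>R H (ys' ! s)] @ nths zs (- S)))"
      proof -
        have "area (c *\<^sub>R H x) y + area x (c *\<^sub>R H y) = 0 * area x y" for x y
          using H(2)[of x y] by (simp add: area_linear flip: distrib_left)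
        moreover have "length ys = 4 + length ys'" using ys that by simp
        ultimately show ?thesis
          using area_tensor_derivation[where N = "\<lambda>x. c *\<^sub>R H x" and \<tau> = 0 and ys = ys' and P = P
            and x = x and y = y and z = z and w = w and zs = "nths zs (- S)"]
          by (simp only: ys(1)) simp
      qed
      also have "(\<Sum>s<length ys'. P (ys'[s := c *\<^sub>R H (ys' ! s)] @ nths zs (- S)))
        = (\<Sum>s<length ys'. c * P (ys'[s := H (ys' ! s)] @ nths zs (- S)))"
      proof (rule sum.cong)
        fix s assume "s \<in> {..<length ys'}"
        then show "P (ys'[s := c *\<^sub>R H (ys' ! s)] @ nths zs (- S))
          = c * P (ys'[s := H (ys' ! s)] @ nths zs (- S))"
          using multilinear_update(3)[OF P refl, of s "ys' @ nths zs (- S)"]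
          by (simp add: list_update_append1)
      qed simp
      finally show ?thesis
        by (simp add: endo c_def sum_distrib_left)
    qed
    have "area_tensor P (ys @ [u, v] @ zs) - area_tensor P (ys @ [v, u] @ zs)
      = area x y * area z w * (P (ys' @ [u, v] @ zs) - P (ys' @ [v, u] @ zs))"
      by (simp add: ys(1) algebra_simps)
    then show ?thesis
      unfolding inner ricci by (simp add: sum_distrib_left)
  qed
  have pointwise: "area_tensor P ([x, y, z, w] @ zs) = - area_tensor P ([y, x, z, w] @ zs)"
    "area_tensor P ([x, y, z, w] @ zs) = area_tensor P ([z, w, x, y] @ zs)"
    "area_tensor P ([x, y, z, w] @ zs) + area_tensor P ([y, z, x, w] @ zs)
      + area_tensor P ([z, x, y, w] @ zs) = 0" for x y z w zs
    by (simp_all add: area_def algebra_simps)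
  have "curvature_identities k B (\<lambda>i. area_tensor P)"
    unfolding curvature_identities_def
    by (intro conjI allI impI; (rule pointwise bianchi2 | (elim conjE, erule ricci')))
  then show ?thesis
    using B multilinear_area_tensor[OF P] by (auto simp: curvature_model_def)
qed

section \<open>The metric \<open>2 (u + v)\<^sup>2 du dv + dz\<^sup>2\<close>\<close>

text \<open>Up to the factor 2 / s this is the Christoffel symbol of the metric. The endomorphisms
  \<open>stretch w\<close> are diagonal, so they commute with each other and with
  \<open>plane_boost\<close>.\<close>

definition stretch :: "real^3 \<Rightarrow> real^3 \<Rightarrow> real^3" where
  "stretch w x = vector [w $ 1 * x $ 1, w $ 2 * x $ 2, 0]"

text \<open>The infinitesimal boost of the (u, v)-plane, to which all curvature endomorphisms are
  proportional.\<close>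

definition plane_boost :: "real^3 \<Rightarrow> real^3" where
  "plane_boost x = vector [x $ 1, - x $ 2, 0]"

text \<open>Serves as the coordinate s on points, as its differential on vectors, and as the trace
  of \<open>stretch w\<close> on the plane.\<close>

definition plane_sum :: "real^3 \<Rightarrow> real" where
  "plane_sum w = w $ 1 + w $ 2"

lemma axis_component: "axis i x $ j = (if j = i then x else 0)"
  by (simp add: axis_def)

lemma vec3_eqI: "x $ 1 = y $ 1 \<Longrightarrow> x $ 2 = y $ 2 \<Longrightarrow> x $ 3 = y $ 3 \<Longrightarrow> x = y"
  for x y :: "real^3"
  by (simp add: vec_eq_iff forall_3)

text \<open>In coordinates with \<open>s = u + v\<close>, the tensor \<open>\<nabla>\<^sup>lR\<close> of \<open>2 s\<^sup>2 du dv + dz\<^sup>2\<close> is \<open>s\<^sup>-\<^sup>l\<close> times the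
  product of the square of the area form with \<open>cone_deriv l\<close>. The factor \<open>l + 4\<close> in the recursion
  collects \<open>l\<close> from differentiating \<open>s\<^sup>-\<^sup>l\<close> and the traces of the Christoffel endomorphism
  on the two area forms.\<close>

primrec cone_deriv :: "nat \<Rightarrow> (real^3) list \<Rightarrow> real" where
  "cone_deriv 0 zs = 2"
| "cone_deriv (Suc l) zs =
     - (real l + 4) * plane_sum (last zs) * cone_deriv l (butlast zs)
     - 2 * (\<Sum>s<l. cone_deriv l ((butlast zs)[s := stretch (last zs) (zs ! s)]))"

abbreviation cone_factor :: "(real^3) list \<Rightarrow> real" where
  "cone_factor zs \<equiv> cone_deriv (length zs) zs"

lemma stretch_linear:
  "stretch w (x + y) = stretch w x + stretch w y" "stretch w (c *\<^sub>R x) = c *\<^sub>R stretch w x"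
  "stretch (w + v) x = stretch w x + stretch v x" "stretch (c *\<^sub>R w) x = c *\<^sub>R stretch w x"
  by (auto intro!: vec3_eqI simp: stretch_def algebra_simps)


text \<open>In the recursion the last argument enters linearly through \<open>plane_sum\<close> and
  \<open>stretch\<close>; an earlier one occupies a single slot of each summand, possibly underneath
  \<open>stretch\<close>.\<close>

lemma multilinear_cone_deriv: "multilinear l (cone_deriv l)"
proof (induction l)
  case 0
  show ?case by (simp add: multilinear_def)
next
  case (Suc l)
  show ?case
    unfolding multilinear_def
  proof (intro allI impI)
    fix vs :: "(real^3) list" and s
    assume vs: "length vs = Suc l \<and> s < Suc l"
    then obtain zs w where zs: "vs = zs @ [w]" "length zs = l"
      by (metis append_butlast_last_id length_append_singleton length_0_conv nat.simps(3) nat.inject)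
    show "linear (\<lambda>v. cone_deriv (Suc l) (vs[s := v]))"
    proof (cases "s = l")
      case True
      have "cone_deriv (Suc l) (vs[s := v]) = - (real l + 4) * plane_sum v * cone_deriv l zs
          - 2 * (\<Sum>s<l. cone_deriv l (zs[s := stretch v (zs ! s)]))" for v
        using zs True by (simp add: nth_append list_update_append)
      note eq = this
      have "linear (\<lambda>v. cone_deriv l (zs[s := stretch v (zs ! s)]))" if "s < l" for s
        using that
        by (intro linearI) (simp_all add: stretch_linear multilinear_update[OF Suc.IH zs(2)])
      then have "linear (\<lambda>v. \<Sum>s<l. cone_deriv l (zs[s := stretch v (zs ! s)]))"
        by (intro linear_compose_sum) auto
      note lin = linear_add[OF this] linear_scale[OF this]
      show ?thesis
        unfolding eq by (auto intro!: linearI simp: lin plane_sum_def algebra_simps)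
    next
      case False
      then have s: "s < l" using vs by simp
      have "linear (\<lambda>v. cone_deriv l (zs[s := v]))"
        using Suc.IH s zs by (simp add: multilinear_def)
      moreover have "linear (\<lambda>v. cone_deriv l (zs[s := v, t := stretch w (zs[s := v] ! t)]))"
        if "t < l" for t
      proof (cases "t = s")
        case True
        then show ?thesis
          using s zs(2)
          by (intro linearI) (simp_all add: stretch_linear multilinear_update[OF Suc.IH zs(2)])
      next
        case False
        then have "linear (\<lambda>v. cone_deriv l (zs[t := stretch w (zs ! t), s := v]))"
          using Suc.IH s zs by (simp add: multilinear_def)
        then show ?thesis
          using False by (simp add: list_update_swap)
      qed
      moreover have "cone_deriv (Suc l) (vs[s := v])
          = (- (real l + 4) * plane_sum w) *\<^sub>R cone_deriv l (zs[s := v])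
          + (- 2 :: real) *\<^sub>R (\<Sum>t<l. cone_deriv l (zs[s := v, t := stretch w (zs[s := v] ! t)]))" for v
        using zs s by (auto simp: list_update_append1 nth_append)
      note eq = this
      ultimately show ?thesis
        unfolding eq
        by (intro linear_compose_add linear_compose_scale_right linear_compose_sum ballI) simp_all
    qed
  qed
qed

section \<open>The Ricci identities for the cone metric\<close>

lemma multilinear_cone_factor: "multilinear r cone_factor"
  using multilinear_cone_deriv[of r] by (simp add: multilinear_def)

definition cone_derivation :: "real^3 \<Rightarrow> (real^3) list \<Rightarrow> real" where
  "cone_derivation w zs = (\<Sum>s<length zs. cone_factor (zs[s := stretch w (zs ! s)]))"

lemma cone_factor_snoc:
  "cone_factor (zs @ [w]) =
    - (real (length zs) + 4) * plane_sum w * cone_factor zs - 2 * cone_derivation w zs"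
  by (simp add: cone_derivation_def nth_append)

text \<open>\<open>stretch\<close> and \<open>plane_sum\<close> do not see the z-direction, so the
  recursion never creates a factor dz. This supplies the planarity required for the second Bianchi
  identity.\<close>

lemma cone_deriv_vertical:
  assumes "length zs = l" "s < l" "x $ 1 = 0" "x $ 2 = 0"
  shows "cone_deriv l (zs[s := x]) = 0"
  using assms
proof (induction l arbitrary: zs s x)
  case (Suc l)
  then obtain ys w where ys: "zs = ys @ [w]" "length ys = l"
    by (metis append_butlast_last_id length_append_singleton length_0_conv nat.simps(3) nat.inject)
  have str: "stretch x y = 0" "stretch y x = 0" for y
    using Suc.prems by (auto intro!: vec3_eqI simp: stretch_def)
  note upd = multilinear_update(4)[OF multilinear_cone_deriv]
  show ?case
  proof (cases "s = l")
    case True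
    then show ?thesis
      using ys Suc.prems
      by (simp add: plane_sum_def str upd nth_append list_update_append)
  next
    case False
    then have s: "s < l" using Suc.prems by simp
    have "cone_deriv l (ys[s := x, t := stretch w (ys[s := x] ! t)]) = 0" if "t < l" for t
    proof (cases "t = s")
      case True
      then show ?thesis using s ys(2) by (simp add: str upd)
    next
      case False
      then show ?thesis
        using Suc.IH[of "ys[t := stretch w (ys ! t)]" s x] Suc.prems s ys
        by (simp add: list_update_swap)
    qed
    then show ?thesis
      using ys s Suc.IH[of ys s x] Suc.prems by (simp add: list_update_append1 nth_append)
  qed
qed auto

lemma cone_factor_planar: "\<exists>a b. \<forall>u. cone_factor (u # zs) = u $ 1 * a + u $ 2 * b"
proof (intro exI allI)
  fix u :: "real^3"
  let ?e = "\<lambda>i. axis i 1 :: real^3"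
  have u: "u = u $ 1 *\<^sub>R ?e 1 + u $ 2 *\<^sub>R ?e 2 + u $ 3 *\<^sub>R ?e 3"
    by (rule vec3_eqI) (simp_all add: axis_component)
  have lin: "linear (\<lambda>v. cone_factor (v # zs))"
    using multilinear_cone_factor[of "Suc (length zs)"]
    unfolding multilinear_def by (elim allE[of _ "0 # zs"] allE[of _ 0]) simp
  have "cone_factor (?e 3 # zs) = 0"
    using cone_deriv_vertical[of "0 # zs" "Suc (length zs)" 0 "?e 3"]
    by (simp add: axis_component del: cone_deriv.simps)
  then show "cone_factor (u # zs)
      = u $ 1 * cone_factor (?e 1 # zs) + u $ 2 * cone_factor (?e 2 # zs)"
    using linear_add[OF lin] linear_scale[OF lin] by (subst u) (simp del: cone_deriv.simps)
qed

text \<open>Every step of the recursion is homogeneous of degree one in the plane: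
  \<open>plane_sum\<close> contributes one factor \<open>c\<close>, and \<open>stretch\<close>,
  being bilinear, contributes one more than its value absorbs.\<close>

lemma cone_deriv_scale:
  assumes "length zs = l"
  shows "cone_deriv l (map (\<lambda>x. vector [c * x $ 1, c * x $ 2, x $ 3]) zs) = c ^ l * cone_deriv l zs"
    (is "cone_deriv l (map ?\<phi> zs) = _")
  using assms
proof (induction l arbitrary: zs)
  case (Suc l)
  then obtain ys w where ys: "zs = ys @ [w]" "length ys = l"
    by (metis append_butlast_last_id length_append_singleton length_0_conv nat.simps(3) nat.inject)
  have str: "stretch (?\<phi> w) (?\<phi> x) = c *\<^sub>R ?\<phi> (stretch w x)" for x
    by (rule vec3_eqI) (simp_all add: stretch_def)
  have "cone_deriv l ((map ?\<phi> ys)[s := stretch (?\<phi> w) (map ?\<phi> ys ! s)])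
      = c * (c ^ l * cone_deriv l (ys[s := stretch w (ys ! s)]))" if "s < l" for s
    using that ys(2) Suc.IH[of "ys[s := stretch w (ys ! s)]"]
    by (simp add: str multilinear_update(3)[OF multilinear_cone_deriv] map_update)
  then show ?case
    using ys Suc.IH[OF ys(2)]
    by (simp add: nth_append plane_sum_def sum_distrib_left algebra_simps)
qed simp

text \<open>The first argument is split off: \<open>T\<close> is affine in \<open>t\<close> through
  it, and the product rule at 0 leaves the sum for the shorter list plus one new term.\<close>

lemma multilinear_has_derivative:
  assumes "multilinear r T" "length X = r"
  shows "((\<lambda>t. T (map (\<lambda>x. x + t *\<^sub>R N x) X)) has_real_derivative
    (\<Sum>i<r. T (X[i := N (X ! i)]))) (at 0)"
  using assms
proof (induction r arbitrary: T X)
  case (Suc r)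
  then obtain x X' where X: "X = x # X'" "length X' = r" by (auto simp: length_Suc_conv)
  have m: "multilinear r (\<lambda>vs. T (y # vs))" for y
    unfolding multilinear_def
  proof (intro allI impI)
    fix vs :: "'a list" and s
    assume "length vs = r \<and> s < r"
    then show "linear (\<lambda>v. T (y # vs[s := v]))"
      using Suc.prems(1)[unfolded multilinear_def, rule_format, of "y # vs" "Suc s"] by simp
  qed
  let ?M = "\<lambda>t. map (\<lambda>x. x + t *\<^sub>R N x) X'"
  have "T (map (\<lambda>x. x + t *\<^sub>R N x) X) = T (x # ?M t) + t * T (N x # ?M t)" for t
    using multilinear_update(1)[OF Suc.prems(1), of "x # ?M t" 0 x "t *\<^sub>R N x"]
      multilinear_update(3)[OF Suc.prems(1), of "x # ?M t" 0 t "N x"] X by simp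
  moreover have "((\<lambda>t. T (x # ?M t) + t * T (N x # ?M t)) has_real_derivative
      (\<Sum>i<r. T (x # X'[i := N (X' ! i)])) + (1 * T (N x # ?M 0)
        + (\<Sum>i<r. T (N x # X'[i := N (X' ! i)])) * 0)) (at 0)"
    by (intro DERIV_add DERIV_mult Suc.IH[OF m X(2)] DERIV_ident)
  ultimately show ?case
    by (simp add: X(1) sum.lessThan_Suc_shift add.commute del: sum.lessThan_Suc)
qed simp

text \<open>Only the first order at \<open>t = 0\<close> matters, so an affine path replaces the
  exponential of \<open>stretch w\<close>.\<close>

definition flow :: "real^3 \<Rightarrow> real \<Rightarrow> (real^3) list \<Rightarrow> (real^3) list" where
  "flow w t = map (\<lambda>x. x + t *\<^sub>R stretch w x)"

lemma cone_factor_flow: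
  "((\<lambda>t. cone_factor (flow w t zs)) has_real_derivative cone_derivation w zs) (at 0)"
  using multilinear_has_derivative[OF multilinear_cone_factor refl, where X = zs and N = "stretch w"]
  by (simp add: flow_def cone_derivation_def)

text \<open>On antisymmetrising in \<open>u\<close> and \<open>v\<close>, the second-order terms
  drop out because the stretches commute, and \<open>stretch v u\<close> is symmetric. The
  first-order terms carry the coefficients \<open>p + 5\<close> and \<open>p + 4\<close>, whose
  difference 1 leaves one commutator. It is a curvature term because \<open>plane_sum v\<close>
  times \<open>stretch u\<close> minus \<open>plane_sum u\<close> times \<open>stretch v\<close> is
  \<open>area u v\<close> times \<open>plane_boost\<close>.\<close>

lemma cone_ricci_base:
  "cone_factor (ys @ [u, v]) - cone_factor (ys @ [v, u])
    = 2 * area u v * (\<Sum>s<length ys. cone_factor (ys[s := plane_boost (ys ! s)]))"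
proof -
  define p where "p = length ys"
  note upd = multilinear_update[OF multilinear_cone_deriv]
  define DD where "DD u v = (\<Sum>i<p. cone_derivation u (ys[i := stretch v (ys ! i)]))" for u v
  have DD: "DD u v = DD v u" for u v
  proof -
    have "DD u v = (\<Sum>i<p. \<Sum>k<p. cone_factor
        (ys[i := stretch v (ys ! i), k := stretch u (ys[i := stretch v (ys ! i)] ! k)]))" for u v
      by (simp add: DD_def cone_derivation_def p_def)
    note D = this
    have "ys[i := stretch v (ys ! i), k := stretch u (ys[i := stretch v (ys ! i)] ! k)]
      = ys[k := stretch u (ys ! k), i := stretch v (ys[k := stretch u (ys ! k)] ! i)]"
      if "i < p" "k < p" for i k
    proof (cases "i = k")
      case True
      have "stretch u (stretch v x) = stretch v (stretch u x)" for x
        by (rule vec3_eqI) (simp_all add: stretch_def)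
      then show ?thesis using True that by (simp add: p_def)
    next
      case False
      then show ?thesis by (simp add: list_update_swap)
    qed
    then show ?thesis
      unfolding D by (subst sum.swap) (auto intro!: sum.cong)
  qed
  have D: "cone_derivation v (ys @ [u]) = - (real p + 4) * plane_sum u * cone_derivation v ys
      - 2 * DD u v + cone_factor (ys @ [stretch v u])" for u v
  proof -
    have "cone_derivation v (ys @ [u]) = (\<Sum>i<p. cone_factor (ys[i := stretch v (ys ! i)] @ [u]))
        + cone_factor (ys @ [stretch v u])"
      by (simp add: cone_derivation_def p_def nth_append list_update_append1
          del: cone_deriv.simps)
    also have "(\<Sum>i<p. cone_factor (ys[i := stretch v (ys ! i)] @ [u]))
        = (\<Sum>i<p. - (real p + 4) * plane_sum u * cone_factor (ys[i := stretch v (ys ! i)])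
          - 2 * cone_derivation u (ys[i := stretch v (ys ! i)]))"
      unfolding cone_factor_snoc by (simp add: p_def)
    also have "\<dots> = - (real p + 4) * plane_sum u * cone_derivation v ys - 2 * DD u v"
      by (simp add: DD_def cone_derivation_def p_def sum_subtractf sum_negf sum_distrib_left)
    finally show ?thesis .
  qed
  have E: "cone_factor (ys @ [u, v]) = - (real p + 5) * plane_sum v *
      (- (real p + 4) * plane_sum u * cone_factor ys - 2 * cone_derivation u ys)
      - 2 * (- (real p + 4) * plane_sum u * cone_derivation v ys
      - 2 * DD u v + cone_factor (ys @ [stretch v u]))" for u v
    using cone_factor_snoc[of "ys @ [u]" v] cone_factor_snoc[of ys u]
    by (simp add: D p_def del: cone_deriv.simps)
  have st: "stretch v u = stretch u v" by (simp add: stretch_def mult.commute)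
  have "plane_sum v * cone_factor (ys[i := stretch u (ys ! i)])
      - plane_sum u * cone_factor (ys[i := stretch v (ys ! i)])
      = area u v * cone_factor (ys[i := plane_boost (ys ! i)])" if "i < p" for i
  proof -
    have "plane_sum v *\<^sub>R stretch u x - plane_sum u *\<^sub>R stretch v x = area u v *\<^sub>R plane_boost x" for x
      by (rule vec3_eqI) (simp_all add: stretch_def plane_boost_def area_def plane_sum_def algebra_simps)
    then show ?thesis
      using that by (simp add: p_def flip: upd(2,3))
  qed
  then have "plane_sum v * cone_derivation u ys - plane_sum u * cone_derivation v ys
      = area u v * (\<Sum>i<p. cone_factor (ys[i := plane_boost (ys ! i)]))"
    by (simp add: cone_derivation_def p_def sum_distrib_left flip: sum_subtractf)
  moreover have "cone_factor (ys @ [u, v]) - cone_factor (ys @ [v, u])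
      = 2 * (plane_sum v * cone_derivation u ys - plane_sum u * cone_derivation v ys)"
    unfolding E DD[of u v] st by (simp add: algebra_simps)
  ultimately show ?thesis by (simp add: p_def)
qed

lemma nths_cong: "(\<And>i. i < length xs \<Longrightarrow> i \<in> A \<longleftrightarrow> i \<in> B) \<Longrightarrow> nths xs A = nths xs B"
  unfolding nths_def by (intro arg_cong[of _ _ "map fst"] filter_cong) (auto simp: in_set_zip)

text \<open>One step of the Leibniz expansion: the new direction \<open>w\<close> joins either
  \<open>S\<close> or its complement.\<close>

lemma sum_nths_snoc:
  fixes F :: "'a list \<Rightarrow> 'a list \<Rightarrow> real"
  shows "(\<Sum>S\<in>Pow {..<length (zs @ [w])}. F (nths (zs @ [w]) S) (nths (zs @ [w]) (- S)))
    = (\<Sum>S\<in>Pow {..<length zs}. F (nths zs S @ [w]) (nths zs (- S))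
        + F (nths zs S) (nths zs (- S) @ [w]))"
proof -
  let ?j = "length zs"
  have P: "Pow {..<length (zs @ [w])} = insert ?j ` Pow {..<?j} \<union> Pow {..<?j}"
    by (simp add: lessThan_Suc Pow_insert Un_commute)
  have inj: "inj_on (insert ?j) (Pow {..<?j})"
    by (rule inj_onI) (metis Diff_insert_absorb Pow_iff lessThan_iff less_irrefl subset_iff)
  have "(\<Sum>S\<in>Pow {..<length (zs @ [w])}. F (nths (zs @ [w]) S) (nths (zs @ [w]) (- S)))
    = (\<Sum>S\<in>Pow {..<?j}. F (nths (zs @ [w]) (insert ?j S)) (nths (zs @ [w]) (- insert ?j S)))
      + (\<Sum>S\<in>Pow {..<?j}. F (nths (zs @ [w]) S) (nths (zs @ [w]) (- S)))"
    unfolding P by (subst sum.union_disjoint) (auto simp: sum.reindex[OF inj])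
  also have "\<dots> = (\<Sum>S\<in>Pow {..<?j}. F (nths zs S @ [w]) (nths zs (- S))
        + F (nths zs S) (nths zs (- S) @ [w]))"
    unfolding sum.distrib
  proof (intro arg_cong2[of _ _ _ _ "(+)"] sum.cong refl)
    fix S assume "S \<in> Pow {..<?j}"
    then have S: "?j \<notin> S" by auto
    show "F (nths (zs @ [w]) (insert ?j S)) (nths (zs @ [w]) (- insert ?j S))
      = F (nths zs S @ [w]) (nths zs (- S))"
      using nths_cong[of zs "insert ?j S" S] nths_cong[of zs "- insert ?j S" "- S"]
      by (auto simp: nths_append)
    show "F (nths (zs @ [w]) S) (nths (zs @ [w]) (- S)) = F (nths zs S) (nths zs (- S) @ [w])"
      using S by (simp add: nths_append)
  qed
  finally show ?thesis .
qed

text \<open>In the induction step the identity is differentiated along the flow of the next direction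
  \<open>w\<close>, which acts on all arguments at once and hence commutes with \<open>nths\<close>.\<close>

lemma cone_ricci:
  "length zs = j \<Longrightarrow> cone_factor (ys @ [u, v] @ zs) - cone_factor (ys @ [v, u] @ zs) =
      (\<Sum>S\<in>Pow {..<length zs}. area u v * cone_factor (nths zs S) *
        (\<Sum>s<length ys. cone_factor (ys[s := plane_boost (ys ! s)] @ nths zs (- S))))"
proof (induction j arbitrary: ys u v zs)
  case 0
  then show ?case
    using cone_ricci_base[of ys u v] by (simp del: cone_deriv.simps(2))
next
  case (Suc j)
  then obtain zs' w where zs: "zs = zs' @ [w]" "length zs' = j"
    by (metis append_butlast_last_id length_append_singleton length_0_conv nat.simps(3) nat.inject)
  define Q where "Q ys zs = (\<Sum>s<length ys. cone_factor (ys[s := plane_boost (ys ! s)] @ zs))" for ys zs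
  define DQ where "DQ zs = (\<Sum>s<length ys. cone_derivation w (ys[s := plane_boost (ys ! s)] @ zs))" for zs
  have Q_snoc: "Q ys (xs @ [w]) = - (real (length ys + length xs) + 4) * plane_sum w * Q ys xs
      - 2 * DQ xs" for xs
  proof -
    have "Q ys (xs @ [w]) = (\<Sum>s<length ys. - (real (length ys + length xs) + 4) * plane_sum w *
        cone_factor (ys[s := plane_boost (ys ! s)] @ xs)
        - 2 * cone_derivation w (ys[s := plane_boost (ys ! s)] @ xs))"
      unfolding Q_def append_assoc[symmetric] cone_factor_snoc by simp
    then show ?thesis
      by (simp add: Q_def DQ_def sum_subtractf sum_negf sum_distrib_left del: cone_deriv.simps)
  qed
  have Q_flow: "((\<lambda>t. Q (flow w t ys) (flow w t xs)) has_real_derivative DQ xs) (at 0)" for xs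
  proof -
    \<comment> \<open>As \<open>plane_boost\<close> commutes with \<open>stretch w\<close>, the flow
      of a boosted argument is the boosted flow.\<close>
    have "plane_boost (x + t *\<^sub>R stretch w x) = plane_boost x + t *\<^sub>R stretch w (plane_boost x)" for x t
      by (rule vec3_eqI) (simp_all add: plane_boost_def stretch_def)
    then have "Q (flow w t ys) (flow w t xs)
        = (\<Sum>s<length ys. cone_factor (flow w t (ys[s := plane_boost (ys ! s)] @ xs)))" for t
      by (simp add: Q_def flow_def map_update del: cone_deriv.simps)
    then show ?thesis
      unfolding DQ_def by (simp del: cone_deriv.simps) (intro DERIV_sum cone_factor_flow)
  qed
  have area_flow: "((\<lambda>t. area (u + t *\<^sub>R stretch w u) (v + t *\<^sub>R stretch w v)) has_real_derivative
      plane_sum w * area u v) (at 0)"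
    unfolding area_def stretch_def plane_sum_def
    by (auto intro!: derivative_eq_intros simp: algebra_simps)
  let ?X = "ys @ [u, v] @ zs'" and ?Y = "ys @ [v, u] @ zs'"
  let ?n = "real (length ys + 2 + length zs')"
  define P where "P S = nths zs' S" for S
  \<comment> \<open>The induction hypothesis holds for arbitrary vectors, hence along the whole
    flow; both sides are the same function of \<open>t\<close> and have the same derivative at
    0.\<close>
  have IH: "cone_factor (flow w t ?X) - cone_factor (flow w t ?Y) =
      (\<Sum>S\<in>Pow {..<j}. area (u + t *\<^sub>R stretch w u) (v + t *\<^sub>R stretch w v)
        * cone_factor (flow w t (P S)) * Q (flow w t ys) (flow w t (P (- S))))" for t
    using Suc.IH[of "flow w t zs'" "flow w t ys" "u + t *\<^sub>R stretch w u" "v + t *\<^sub>R stretch w v"] zs(2)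
    by (simp add: flow_def Q_def P_def nths_map del: cone_deriv.simps)
  have flow0: "flow w 0 xs = xs" for xs by (simp add: flow_def)
  have "((\<lambda>t. cone_factor (flow w t ?X) - cone_factor (flow w t ?Y)) has_real_derivative
      cone_derivation w ?X - cone_derivation w ?Y) (at 0)"
    by (intro DERIV_diff cone_factor_flow)
  moreover have "((\<lambda>t. cone_factor (flow w t ?X) - cone_factor (flow w t ?Y)) has_real_derivative
      (\<Sum>S\<in>Pow {..<j}. (plane_sum w * area u v * cone_factor (P S)
          + cone_derivation w (P S) * area u v) * Q ys (P (- S))
        + DQ (P (- S)) * (area u v * cone_factor (P S)))) (at 0)"
    unfolding IH
    using DERIV_mult[OF DERIV_mult[OF area_flow cone_factor_flow[of w]] Q_flow, unfolded flow0]
    by (intro DERIV_sum) (simp add: flow0 del: cone_deriv.simps)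
  ultimately have D: "cone_derivation w ?X - cone_derivation w ?Y =
      (\<Sum>S\<in>Pow {..<j}. (plane_sum w * area u v * cone_factor (P S)
          + cone_derivation w (P S) * area u v) * Q ys (P (- S))
        + DQ (P (- S)) * (area u v * cone_factor (P S)))"
    by (rule DERIV_unique)
  have "cone_factor (?X @ [w]) - cone_factor (?Y @ [w]) =
      - (?n + 4) * plane_sum w * (cone_factor ?X - cone_factor ?Y)
      - 2 * (cone_derivation w ?X - cone_derivation w ?Y)"
    unfolding cone_factor_snoc by (simp add: algebra_simps del: cone_deriv.simps)
  also have "\<dots> = (\<Sum>S\<in>Pow {..<j}.
      - (?n + 4) * plane_sum w * (area u v * cone_factor (P S) * Q ys (P (- S)))
      - 2 * ((plane_sum w * area u v * cone_factor (P S)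
          + cone_derivation w (P S) * area u v) * Q ys (P (- S))
        + DQ (P (- S)) * (area u v * cone_factor (P S))))"
    using IH[of 0] unfolding D flow0
    by (simp add: sum_subtractf sum_negf sum_distrib_left del: cone_deriv.simps)
  also have "\<dots> = (\<Sum>S\<in>Pow {..<j}. area u v * cone_factor (P S @ [w]) * Q ys (P (- S))
      + area u v * cone_factor (P S) * Q ys (P (- S) @ [w]))"
  proof (intro sum.cong refl)
    fix S assume "S \<in> Pow {..<j}"
    \<comment> \<open>Bookkeeping of weights: on the left the recursion weight exceeds the number of
      slots by 4, \<open>u\<close> and \<open>v\<close> count as slots, and the moving area form
      adds 2, in total 8. On the right two recursions contribute 4 each.\<close>
    have "length (P S) + length (P (- S)) = card ({i. i < j \<and> i \<in> S} \<union> {i. i < j \<and> i \<in> - S})"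
      using zs(2) unfolding P_def length_nths by (subst card_Un_disjoint) auto
    also have "{i. i < j \<and> i \<in> S} \<union> {i. i < j \<and> i \<in> - S} = {..<j}" by auto
    finally have n: "?n = real (length ys) + 2 + real (length (P S)) + real (length (P (- S)))"
      using zs(2) by simp
    show "- (?n + 4) * plane_sum w * (area u v * cone_factor (P S) * Q ys (P (- S)))
      - 2 * ((plane_sum w * area u v * cone_factor (P S)
          + cone_derivation w (P S) * area u v) * Q ys (P (- S))
        + DQ (P (- S)) * (area u v * cone_factor (P S)))
      = area u v * cone_factor (P S @ [w]) * Q ys (P (- S))
      + area u v * cone_factor (P S) * Q ys (P (- S) @ [w])"
      unfolding n cone_factor_snoc Q_snoc by (simp add: algebra_simps del: cone_deriv.simps)
  qed
  also have "\<dots> = (\<Sum>S\<in>Pow {..<length zs}. area u v * cone_factor (nths zs S) * Q ys (nths zs (- S)))"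
    unfolding zs(1) P_def
    using sum_nths_snoc[of "\<lambda>a b. area u v * cone_factor a * Q ys b" zs' w] zs(2)
    by (simp del: cone_deriv.simps)
  finally show ?case unfolding zs(1) Q_def by (simp del: cone_deriv.simps)
qed

section \<open>Manifolds with a single chart\<close>

definition chart_manifold :: "(real^'n) set \<Rightarrow> (real^'n \<Rightarrow> real^'n^'n) \<Rightarrow> (real^'n, 'n::finite) pr_manifold" where
  "chart_manifold U g = \<lparr> topol = top_of_set U, atlas = {(U, \<lambda>p. p)}, metric = (\<lambda>c. g) \<rparr>"

lemma chart_manifold_simps [simp]:
  "topol (chart_manifold U g) = top_of_set U"
  "atlas (chart_manifold U g) = {(U, \<lambda>p. p)}"
  "metric (chart_manifold U g) c = g"
  by (simp_all add: chart_manifold_def)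

lemma second_countable_euclidean:
  "second_countable (euclidean :: 'a::second_countable_topology topology)"
proof -
  obtain \<B> :: "'a set set" where \<B>: "countable \<B>" "topological_basis \<B>"
    using ex_countable_basis by blast
  have "\<exists>V\<in>\<B>. x \<in> V \<and> V \<subseteq> U" if "open U" "x \<in> U" for U x
    using topological_basisE[OF \<B>(2) that] by metis
  then show ?thesis
    unfolding second_countable_def using \<B> topological_basis_open by (intro exI[of _ \<B>]) auto
qed

lemma pseudo_riemannian_chart_manifold:
  assumes U: "open U" and g: "smooth_on U g"
    and nondeg: "\<And>p. p \<in> U \<Longrightarrow> transpose (g p) = g p \<and> invertible (g p)"
  shows "pseudo_riemannian (chart_manifold U g)"
proof -
  let ?\<psi> = "coord_rep (U, \<lambda>p. p) (U, \<lambda>p. p) (\<lambda>P. P)"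
  \<comment> \<open>\<open>inv_into U\<close> inverts the identity on \<open>U\<close> only, so the
    equality with the identity map is local.\<close>
  have eq: "p = ?\<psi> p" if "p \<in> U" for p
    using that inv_into_f_f[of "\<lambda>p. p" U p] by (simp add: coord_rep_def inj_on_def)
  note eq' = eq[symmetric]
  have d: "dir_deriv ?\<psi> p v = v" if "p \<in> U" for p v
  proof -
    have "dir_deriv ?\<psi> p v = dir_deriv (\<lambda>p. p) p v"
      by (rule dir_deriv_cong_open[OF U that eq'])
    also have "\<dots> = v" by (simp add: dir_deriv_eq[OF has_derivative_ident])
    finally show ?thesis .
  qed
  have "smooth_on U ?\<psi>"
    by (rule smooth_on_cong[OF U eq smooth_on_bounded_linear[OF bounded_linear_ident]])
  moreover have "{P \<in> U. P \<in> U} = U" by auto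
  ultimately have "isometric_on (chart_manifold U g) U (\<lambda>P. P)"
    using U d by (simp add: isometric_on_def Let_def eq')
  moreover have "homeomorphic_map (top_of_set U) (top_of_set U) (\<lambda>p. p)"
    by (rule homeomorphic_map_id[unfolded id_def, THEN iffD2]) simp
  moreover have "second_countable (top_of_set U)"
    by (simp add: second_countable_subtopology second_countable_euclidean)
  ultimately show ?thesis
    using assms
    by (simp add: pseudo_riemannian_def Hausdorff_space_subtopology subtopology_subtopology)
qed

lemma matrix_inv_mult_left: "invertible A \<Longrightarrow> matrix_inv A ** A = mat 1"
  unfolding invertible_def matrix_inv_def by (metis (mono_tags, lifting) someI_ex)

text \<open>Multiplying by the metric replaces the computation of an inverse matrix by a check of
  the Koszul formula.\<close>

lemma christoffel_eqI:
  assumes "invertible (G p)"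
    and "\<And>i. (G p *v c) $ i = (dir_deriv (\<lambda>q. metric_form G q v (axis i 1)) p u
           + dir_deriv (\<lambda>q. metric_form G q u (axis i 1)) p v
           - dir_deriv (\<lambda>q. metric_form G q u v) p (axis i 1)) / 2"
  shows "christoffel G p u v = c"
proof -
  have "christoffel G p u v = matrix_inv (G p) *v (G p *v c)"
    unfolding christoffel_def assms(2)[symmetric] by simp
  also have "\<dots> = c"
    using assms(1) by (simp add: matrix_vector_mul_assoc matrix_inv_mult_left)
  finally show ?thesis .
qed

lemma has_derivative_compose_scaleR:
  assumes "bounded_linear L" "(F has_real_derivative F') (at (L p))"
  shows "((\<lambda>q. F (L q) *\<^sub>R a) has_derivative (\<lambda>u. (L u * F') *\<^sub>R a)) (at p)"
proof -
  have "((\<lambda>q. F (L q)) has_derivative (\<lambda>u. F' * L u)) (at p)"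
    using has_derivative_compose[OF bounded_linear_imp_has_derivative[OF assms(1)]]
      assms(2) unfolding has_field_derivative_def by blast
  then show ?thesis
    by (simp add: has_derivative_scaleR_left mult.commute)
qed

lemma dir_deriv_compose:
  assumes "bounded_linear L" "(F has_real_derivative F') (at (L p))"
  shows "dir_deriv (\<lambda>q. F (L q) *\<^sub>R a) p u = (L u * F') *\<^sub>R a"
    and "dir_deriv (\<lambda>q. F (L q) * b) p u = L u * F' * b"
  using dir_deriv_eq[OF has_derivative_compose_scaleR[OF assms]]
    dir_deriv_eq[OF has_derivative_compose_scaleR[OF assms, of b]] by auto

section \<open>Connection and curvature of the cone metric\<close>

definition cone_metric :: "real^3 \<Rightarrow> real^3^3" where
  "cone_metric p = vector [vector [0, (plane_sum p)\<^sup>2, 0], vector [(plane_sum p)\<^sup>2, 0, 0], vector [0, 0, 1]]"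

definition cone_domain :: "(real^3) set" where
  "cone_domain = {p. plane_sum p > 0}"

lemma bounded_linear_plane_sum: "bounded_linear plane_sum"
  unfolding plane_sum_def by (intro bounded_linear_add bounded_linear_vec_nth)

lemma cone_domain: "open cone_domain" "connected cone_domain"
proof -
  have eq: "cone_domain = plane_sum -` {0<..}" by (auto simp: cone_domain_def)
  show "open cone_domain"
    unfolding eq using bounded_linear_plane_sum
    by (intro open_vimage) (auto simp: linear_continuous_on)
  have "convex cone_domain"
    unfolding eq using bounded_linear_plane_sum
    by (intro convex_linear_vimage bounded_linear.linear) auto
  then show "connected cone_domain" by (rule convex_connected)
qed

lemma metric_form_cone:
  "metric_form cone_metric p v w = (plane_sum p)\<^sup>2 * (v $ 1 * w $ 2 + v $ 2 * w $ 1) + v $ 3 * w $ 3"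
  by (simp add: metric_form_def cone_metric_def inner_vec_def sum_3 matrix_vector_mult_def
      algebra_simps)

lemma plane_sum_axis:
  "plane_sum (axis 1 1) = 1" "plane_sum (axis 2 1) = 1" "plane_sum (axis 3 1) = 0"
  by (simp_all add: plane_sum_def axis_component)

lemma invertible_cone_metric: "p \<in> cone_domain \<Longrightarrow> invertible (cone_metric p)"
  by (simp add: invertible_det_nz det_3 cone_metric_def cone_domain_def)

lemma christoffel_cone:
  assumes p: "p \<in> cone_domain"
  shows "christoffel cone_metric p u v = (2 / plane_sum p) *\<^sub>R stretch u v"
proof (rule christoffel_eqI)
  show "invertible (cone_metric p)" by (rule invertible_cone_metric[OF p])
  have D: "dir_deriv (\<lambda>q. metric_form cone_metric q v w) p u
      = 2 * plane_sum p * plane_sum u * (v $ 1 * w $ 2 + v $ 2 * w $ 1)" for u v w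
    unfolding metric_form_cone
    by (rule dir_deriv_eq, rule has_derivative_eq_rhs)
      (auto intro!: derivative_eq_intros bounded_linear_imp_has_derivative bounded_linear_plane_sum)
  have p0: "plane_sum p \<noteq> 0" using p by (simp add: cone_domain_def)
  have "\<forall>i. (cone_metric p *v ((2 / plane_sum p) *\<^sub>R stretch u v)) $ i =
         (dir_deriv (\<lambda>q. metric_form cone_metric q v (axis i 1)) p u
           + dir_deriv (\<lambda>q. metric_form cone_metric q u (axis i 1)) p v
           - dir_deriv (\<lambda>q. metric_form cone_metric q u v) p (axis i 1)) / 2"
    using p0 unfolding D forall_3
    by (simp add: matrix_vector_mult_def sum_3 cone_metric_def stretch_def axis_component
        plane_sum_axis plane_sum_def[of u] plane_sum_def[of v] power2_eq_square field_simps)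
  then show "(cone_metric p *v ((2 / plane_sum p) *\<^sub>R stretch u v)) $ i =
         (dir_deriv (\<lambda>q. metric_form cone_metric q v (axis i 1)) p u
           + dir_deriv (\<lambda>q. metric_form cone_metric q u (axis i 1)) p v
           - dir_deriv (\<lambda>q. metric_form cone_metric q u v) p (axis i 1)) / 2" for i
    by blast
qed

text \<open>The Christoffel endomorphisms commute, so the quadratic terms cancel and only the
  derivative of 2 / s contributes.\<close>

lemma curv_endo_cone:
  assumes p: "p \<in> cone_domain"
  shows "curv_endo cone_metric p u v w = (2 * area u v / (plane_sum p)\<^sup>2) *\<^sub>R plane_boost w"
proof -
  have p0: "plane_sum p \<noteq> 0" using p by (simp add: cone_domain_def)
  have D: "dir_deriv (\<lambda>q. christoffel cone_metric q v w) p u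
      = (plane_sum u * (- 2 / (plane_sum p)\<^sup>2)) *\<^sub>R stretch v w" for u v w
  proof -
    have "dir_deriv (\<lambda>q. christoffel cone_metric q v w) p u
      = dir_deriv (\<lambda>q. (2 / plane_sum q) *\<^sub>R stretch v w) p u"
      by (rule dir_deriv_cong_open[OF cone_domain(1) p]) (rule christoffel_cone)
    also have "\<dots> = (plane_sum u * (- 2 / (plane_sum p)\<^sup>2)) *\<^sub>R stretch v w"
      by (rule dir_deriv_compose(1)[OF bounded_linear_plane_sum])
        (use p0 in \<open>auto intro!: derivative_eq_intros simp: power2_eq_square\<close>)
    finally show ?thesis .
  qed
  define k where "k = 1 / plane_sum p"
  have k: "2 / plane_sum p = 2 * k" "- 2 / (plane_sum p)\<^sup>2 = - 2 * k\<^sup>2"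
    "2 * area u v / (plane_sum p)\<^sup>2 = 2 * area u v * k\<^sup>2"
    by (simp_all add: k_def power_divide)
  show ?thesis
    unfolding curv_endo_def D christoffel_cone[OF p] k
    by (intro vec3_eqI)
      (simp_all add: stretch_def plane_boost_def area_def plane_sum_def power2_eq_square algebra_simps)
qed

lemma stretch_trace: "area (stretch w x) y + area x (stretch w y) = plane_sum w * area x y"
  by (simp add: area_def stretch_def plane_sum_def algebra_simps)

lemma inverse_power_has_derivative:
  fixes s :: real
  assumes "s \<noteq> 0"
  shows "((\<lambda>x. inverse (x ^ l)) has_real_derivative - real l / s ^ Suc l) (at s)"
proof (rule DERIV_cong)
  show "((\<lambda>x. inverse (x ^ l)) has_real_derivative
      - (inverse (s ^ l) * (real l * s ^ (l - Suc 0)) * inverse (s ^ l))) (at s)"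
    using assms by (intro DERIV_inverse' DERIV_pow) simp
  show "- (inverse (s ^ l) * (real l * s ^ (l - Suc 0)) * inverse (s ^ l)) = - real l / s ^ Suc l"
    using assms by (cases l) (simp_all add: field_simps)
qed

lemma nabla_curv_cone:
  assumes "p \<in> cone_domain" "length vs = 4 + l"
  shows "nabla_curv cone_metric l p vs = area_tensor cone_factor vs / plane_sum p ^ l"
  using assms
proof (induction l arbitrary: p vs)
  case 0
  then have "plane_sum p \<noteq> 0" by (simp add: cone_domain_def)
  then show ?case
    using 0 by (simp add: metric_form_cone curv_endo_cone area_tensor_def plane_boost_def area_def
        field_simps)
next
  case (Suc l)
  define s where "s = plane_sum p"
  have s: "s > 0" using Suc.prems by (simp add: s_def cone_domain_def)
  obtain X w where X: "vs = X @ [w]" "length X = 4 + l"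
    using Suc.prems(2)
    by (metis add_Suc_right append_butlast_last_id length_append_singleton length_0_conv nat.simps(3) nat.inject)
  obtain x y z v ys where ys: "X = [x, y, z, v] @ ys" "length ys = l"
    using list_4_append X(2) by blast
  have "dir_deriv (\<lambda>q. nabla_curv cone_metric l q X) p w
      = dir_deriv (\<lambda>q. inverse (plane_sum q ^ l) * area_tensor cone_factor X) p w"
    by (rule dir_deriv_cong_open[OF cone_domain(1) Suc.prems(1)])
      (simp add: Suc.IH X(2) divide_inverse mult.commute)
  also have "\<dots> = plane_sum w * (- real l / s ^ Suc l) * area_tensor cone_factor X"
    unfolding s_def
    by (rule dir_deriv_compose(2)[OF bounded_linear_plane_sum inverse_power_has_derivative])
      (use s in \<open>simp add: s_def\<close>)
  finally have D: "dir_deriv (\<lambda>q. nabla_curv cone_metric l q X) p w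
      = plane_sum w * (- real l / s ^ Suc l) * area_tensor cone_factor X" .
  have "nabla_curv cone_metric l p (X[t := christoffel cone_metric p w (X ! t)])
      = 2 / s ^ Suc l * area_tensor cone_factor (X[t := stretch w (X ! t)])" if "t < 4 + l" for t
    using that Suc.IH[OF Suc.prems(1)] X(2) s
    by (simp add: christoffel_cone[OF Suc.prems(1)] s_def
        multilinear_update(3)[OF multilinear_area_tensor[OF multilinear_cone_factor, of l]])
  then have "(\<Sum>t<4 + l. nabla_curv cone_metric l p (X[t := christoffel cone_metric p w (X ! t)]))
      = 2 / s ^ Suc l * (\<Sum>t<4 + l. area_tensor cone_factor (X[t := stretch w (X ! t)]))"
    unfolding sum_distrib_left by (intro sum.cong) auto
  also have "(\<Sum>t<4 + l. area_tensor cone_factor (X[t := stretch w (X ! t)]))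
      = area x y * area z v * (2 * plane_sum w * cone_factor ys + cone_derivation w ys)"
    using area_tensor_derivation[where N = "stretch w" and \<tau> = "plane_sum w" and P = cone_factor and
        ys = ys and x = x and y = y and z = z and w = v and zs = "[]"]
    by (simp only: ys stretch_trace append_Nil2 cone_derivation_def)
  finally have S: "(\<Sum>t<4 + l. nabla_curv cone_metric l p (X[t := christoffel cone_metric p w (X ! t)]))
      = 2 / s ^ Suc l * (area x y * area z v * (2 * plane_sum w * cone_factor ys + cone_derivation w ys))" .
  have vs: "vs = [x, y, z, v] @ (ys @ [w])" using X ys by simp
  have "nabla_curv cone_metric (Suc l) p vs
      = dir_deriv (\<lambda>q. nabla_curv cone_metric l q X) p w
      - (\<Sum>t<4 + l. nabla_curv cone_metric l p (X[t := christoffel cone_metric p w (X ! t)]))"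
    using X by (simp add: nth_append)
  also have "\<dots> = area_tensor cone_factor vs / s ^ Suc l"
    unfolding D S vs area_tensor_Cons4(1) cone_factor_snoc
    using ys s by (simp add: field_simps del: cone_deriv.simps)
  finally show ?case unfolding s_def .
qed

text \<open>The value of \<open>cone_metric\<close> at the points with s = 1, on which the model is
  based.\<close>

definition cone_form :: "real^3 \<Rightarrow> real^3 \<Rightarrow> real" where
  "cone_form v w = v $ 1 * w $ 2 + v $ 2 * w $ 1 + v $ 3 * w $ 3"

lemma bilinear_coordinate_form:
  fixes B :: "real^'n \<Rightarrow> real^'n \<Rightarrow> real"
  assumes "\<And>x y z. B (x + y) z = B x z + B y z" "\<And>c x z. B (c *\<^sub>R x) z = c * B x z"
    and "\<And>x y. B x y = B y x"
  shows "bilinear B"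
  unfolding bilinear_def
proof (intro conjI allI)
  show "linear (\<lambda>y. B x y)" for x
    by (rule linearI) (metis assms real_scaleR_def)+
  show "linear (\<lambda>x. B x y)" for y
    by (rule linearI) (simp_all add: assms(1,2))
qed

lemma nondegenerate_cone_form: "nondegenerate_inner_product cone_form"
  unfolding nondegenerate_inner_product_def
proof (intro conjI allI impI)
  show "bilinear cone_form"
    by (rule bilinear_coordinate_form) (simp_all add: cone_form_def algebra_simps)
  show "cone_form v w = cone_form w v" for v w
    by (simp add: cone_form_def algebra_simps)
  fix v assume v: "\<forall>w. cone_form v w = 0"
  show "v = 0"
    using v[rule_format, of "axis 1 1"] v[rule_format, of "axis 2 1"] v[rule_format, of "axis 3 1"]
    by (intro vec3_eqI) (simp_all add: cone_form_def axis_component)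
qed

lemma curvature_model_cone: "curvature_model k cone_form (\<lambda>i. area_tensor cone_factor)"
proof (rule curvature_model_area_tensor[where H = plane_boost])
  show "cone_form (plane_boost x) y = area x y" "area (plane_boost x) y + area x (plane_boost y) = 0" for x y
    by (simp_all add: cone_form_def plane_boost_def area_def algebra_simps)
qed (use nondegenerate_cone_form multilinear_cone_factor cone_factor_planar cone_ricci[OF refl]
  in blast)+

abbreviation cone_manifold :: "(real^3, 3) pr_manifold" where
  "cone_manifold \<equiv> chart_manifold cone_domain cone_metric"

lemma pseudo_riemannian_cone: "pseudo_riemannian cone_manifold"
proof (rule pseudo_riemannian_chart_manifold[OF cone_domain(1)])
  have "elementary (\<lambda>p::real^3. (plane_sum p)\<^sup>2)"
    unfolding power2_eq_square
    by (intro elementary.intros bounded_linear_plane_sum)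
  then have "elementary (\<lambda>p. cone_metric p $ i $ j)" for i j
    using exhaust_3[of i] exhaust_3[of j] by (auto simp: cone_metric_def intro: elementary.const)
  then show "smooth_on cone_domain cone_metric"
    by (rule matrix_elementary_smooth_on)
  show "transpose (cone_metric p) = cone_metric p \<and> invertible (cone_metric p)"
    if "p \<in> cone_domain" for p
    using invertible_cone_metric[OF that]
    by (simp add: transpose_def vec_eq_iff forall_3 cone_metric_def)
qed

section \<open>Homothety homogeneity of the cone metric without variable homogeneity\<close>

lemma linear_bij_scaling:
  assumes "c \<noteq> 0"
  shows "linear (\<lambda>x::real^3. vector [c * x $ 1, c * x $ 2, x $ 3] :: real^3)"
    and "bij (\<lambda>x::real^3. vector [c * x $ 1, c * x $ 2, x $ 3] :: real^3)"
proof -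
  show "linear (\<lambda>x::real^3. vector [c * x $ 1, c * x $ 2, x $ 3] :: real^3)"
    by (rule linearI; rule vec3_eqI) (simp_all add: algebra_simps)
  show "bij (\<lambda>x::real^3. vector [c * x $ 1, c * x $ 2, x $ 3] :: real^3)"
    by (rule o_bij[where g = "\<lambda>x::real^3. vector [x $ 1 / c, x $ 2 / c, x $ 3]"])
      (use assms in \<open>auto intro!: ext vec3_eqI\<close>)
qed

lemma homothety_curv_hom_cone: "homothety_curv_hom k cone_manifold"
  unfolding homothety_curv_hom_def
proof (intro exI conjI)
  show "curvature_model k cone_form (\<lambda>i. area_tensor cone_factor)"
    by (rule curvature_model_cone)
  have "\<exists>\<phi> \<mu>. tangent_isometry cone_manifold (cone_domain, \<lambda>p. p) p cone_form \<phi> \<and> \<mu> \<noteq> 0 \<and>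
       (\<forall>l\<le>k. pulls_back_to cone_manifold (cone_domain, \<lambda>p. p) p
         (\<lambda>i. area_tensor cone_factor) l \<phi> (\<mu> ^ (2 + l)))" if p: "p \<in> cone_domain" for p
  proof (intro exI conjI allI impI)
    \<comment> \<open>Stretching the plane by the value of s turns the metric at \<open>p\<close>
      into the one at s = 1.\<close>
    define c where "c = plane_sum p"
    have c: "c > 0" using p by (simp add: c_def cone_domain_def)
    let ?\<phi> = "\<lambda>x. vector [c * x $ 1, c * x $ 2, x $ 3] :: real^3"
    show "tangent_isometry cone_manifold (cone_domain, \<lambda>p. p) p cone_form ?\<phi>"
      using linear_bij_scaling[of c] c
      by (simp add: tangent_isometry_def metric_form_cone cone_form_def c_def[symmetric]
          algebra_simps power2_eq_square)
    show "c\<^sup>2 \<noteq> 0" using c by simp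
    fix l
    show "pulls_back_to cone_manifold (cone_domain, \<lambda>p. p) p
         (\<lambda>i. area_tensor cone_factor) l ?\<phi> ((c\<^sup>2) ^ (2 + l))"
      unfolding pulls_back_to_def
    proof (intro allI impI)
      fix vs :: "(real^3) list" assume vs: "length vs = 4 + l"
      obtain x y z v ys where ys: "vs = [x, y, z, v] @ ys" "length ys = l"
        using list_4_append vs by blast
      have a: "area (?\<phi> x) (?\<phi> y) = c\<^sup>2 * area x y" for x y
        by (simp add: area_def power2_eq_square algebra_simps)
      \<comment> \<open>The two area forms give \<open>c^4\<close> and \<open>cone_factor\<close>
        gives \<open>c^l\<close>, whereas the curvature derivative carries \<open>c^(-l)\<close>.
        The quotient \<open>c^(4 + 2 l)\<close> is the required power of the square of
        \<open>c\<close>, which is why that square is the homothety factor.\<close>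
      have "area_tensor cone_factor (map ?\<phi> vs) = (c\<^sup>2 * c\<^sup>2 * c ^ l) * area_tensor cone_factor vs"
        using cone_deriv_scale[OF ys(2), of c] ys by (simp add: a)
      also have "\<dots> = (c\<^sup>2) ^ (2 + l) * (area_tensor cone_factor vs / c ^ l)"
        using c by (simp add: power_add power_mult_distrib power2_eq_square)
      finally show "area_tensor cone_factor (map ?\<phi> vs) = (c\<^sup>2) ^ (2 + l) *
        nabla_curv (metric cone_manifold (cone_domain, \<lambda>p. p)) l (snd (cone_domain, \<lambda>p. p) p) vs"
        using p vs by (simp add: nabla_curv_cone c_def)
    qed
  qed
  then show "homothety_curv_hom_model k cone_manifold cone_form (\<lambda>i. area_tensor cone_factor)"
    by (simp add: homothety_curv_hom_model_def)
qed

text \<open>The kernel of the curvature is the z-axis, so \<open>T\<close> maps it to itself and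
  hence maps its orthogonal complement, the plane, to the plane. There the Gram determinant is minus
  the fourth power of s times the squared area, and \<open>T\<close> respects both; this is the
  invariance of the scalar curvature.\<close>

lemma cone_isometry_invariant:
  assumes T: "linear T" "surj T"
    and met: "\<And>v w. metric_form cone_metric q (T v) (T w) = metric_form cone_metric p v w"
    and curv: "\<And>x y. (area (T x) (T y))\<^sup>2 = (area x y)\<^sup>2"
  shows "(plane_sum q)^4 = (plane_sum p)^4"
proof -
  define a b e where "a = T (axis 1 1)" and "b = T (axis 2 1)" and "e = T (axis 3 1)"
  have ker: "area e y = 0" for y
  proof -
    obtain x where "y = T x" using T(2) by blast
    then show ?thesis using curv[of "axis 3 1" x] by (simp add: e_def area_def axis_component)
  qed
  have e0: "e $ 1 = 0" "e $ 2 = 0"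
    using ker[of "axis 1 1"] ker[of "axis 2 1"] by (simp_all add: area_def axis_component)
  have "e $ 3 * e $ 3 = 1" "a $ 3 * e $ 3 = 0" "b $ 3 * e $ 3 = 0"
    using met[of "axis 3 1" "axis 3 1"] met[of "axis 1 1" "axis 3 1"] met[of "axis 2 1" "axis 3 1"] e0
    by (simp_all add: metric_form_cone axis_component flip: a_def b_def e_def)
  then have ab: "a $ 3 = 0" "b $ 3 = 0" by auto
  have g: "(plane_sum q)\<^sup>2 * (a $ 1 * a $ 2) = 0" "(plane_sum q)\<^sup>2 * (b $ 1 * b $ 2) = 0"
    "(plane_sum q)\<^sup>2 * (a $ 1 * b $ 2 + a $ 2 * b $ 1) = (plane_sum p)\<^sup>2"
    using met[of "axis 1 1" "axis 1 1"] met[of "axis 2 1" "axis 2 1"] met[of "axis 1 1" "axis 2 1"] ab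
    by (simp_all add: metric_form_cone axis_component flip: a_def b_def e_def)
  have one: "(area a b)\<^sup>2 = 1"
    using curv[of "axis 1 1" "axis 2 1"] by (simp add: area_def axis_component a_def b_def)
  \<comment> \<open>The square of a difference of two products is the square of their sum minus four
    times the product; the right-hand side is minus the Gram determinant of \<open>a\<close> and
    \<open>b\<close>.\<close>
  have "(plane_sum q)^4 = (plane_sum q)^4 * (area a b)\<^sup>2" by (simp add: one)
  also have "\<dots> = ((plane_sum q)\<^sup>2 * (a $ 1 * b $ 2 + a $ 2 * b $ 1))\<^sup>2
      - 4 * ((plane_sum q)\<^sup>2 * (a $ 1 * a $ 2)) * ((plane_sum q)\<^sup>2 * (b $ 1 * b $ 2))"
    by (simp add: area_def power2_eq_square power4_eq_xxxx algebra_simps)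
  also have "\<dots> = (plane_sum p)^4" unfolding g by simp
  finally show ?thesis .
qed

text \<open>Eliminates the unknown model: composing one identification with the inverse of another
  compares two tangent spaces directly. All failures of homogeneity are proved through such a
  \<open>T\<close>.\<close>

lemma tangent_isometry_transition:
  assumes "tangent_isometry M c P B \<phi>" "tangent_isometry M d Q B \<theta>"
  obtains T where "linear T" "bij T" "\<And>v. \<theta> (T v) = \<phi> v"
    "\<And>v w. metric_form (metric M d) (snd d Q) (T v) (T w) = metric_form (metric M c) (snd c P) v w"
proof -
  have \<phi>: "linear \<phi>" "bij \<phi>" "\<And>v w. B (\<phi> v) (\<phi> w) = metric_form (metric M c) (snd c P) v w"
    and \<theta>: "linear \<theta>" "bij \<theta>" "\<And>v w. B (\<theta> v) (\<theta> w) = metric_form (metric M d) (snd d Q) v w"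
    using assms by (auto simp: tangent_isometry_def)
  obtain \<theta>' where \<theta>': "linear \<theta>'" "\<theta>' \<circ> \<theta> = id"
    using linear_injective_left_inverse[OF \<theta>(1)] \<theta>(2) bij_is_inj by blast
  then have inv: "\<theta>' = inv \<theta>"
    by (metis \<theta>(2) bij_is_surj comp_def id_apply inv_f_f bij_is_inj ext surjD)
  show thesis
  proof
    show "linear (\<theta>' \<circ> \<phi>)" using \<theta>'(1) \<phi>(1) by (rule linear_compose[rotated])
    show "bij (\<theta>' \<circ> \<phi>)" using \<phi>(2) \<theta>(2) by (simp add: inv bij_imp_bij_inv bij_comp)
    show eq: "\<theta> ((\<theta>' \<circ> \<phi>) v) = \<phi> v" for v
      using \<theta>(2) by (simp add: inv bij_is_surj surj_f_inv_f)
    show "metric_form (metric M d) (snd d Q) ((\<theta>' \<circ> \<phi>) v) ((\<theta>' \<circ> \<phi>) w)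
      = metric_form (metric M c) (snd c P) v w" for v w
      by (metis eq \<theta>(3) \<phi>(3))
  qed
qed

text \<open>Level 0 belongs to every \<open>k\<close>, so the curvature tensor alone decides. On the
  arguments x, y, x, y it is twice the squared area.\<close>

lemma not_variable_curv_hom_cone: "\<not> variable_curv_hom k cone_manifold"
proof
  assume "variable_curv_hom k cone_manifold"
  then obtain B :: "real^3 \<Rightarrow> real^3 \<Rightarrow> real" and A where BA: "variable_curv_hom_model k cone_manifold B A"
    by (auto simp: variable_curv_hom_def)
  let ?c = "(cone_domain, \<lambda>p. p) :: (real^3) set \<times> (real^3 \<Rightarrow> real^3)"
  define p q :: "real^3" where "p = vector [1, 0, 0]" and "q = vector [2, 0, 0]"
  have s: "plane_sum p = 1" "plane_sum q = 2" by (simp_all add: p_def q_def plane_sum_def)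
  have dom: "p \<in> cone_domain" "q \<in> cone_domain" by (simp_all add: cone_domain_def s)
  obtain \<phi> where \<phi>: "tangent_isometry cone_manifold ?c p B \<phi>" "pulls_back_to cone_manifold ?c p A 0 \<phi> 1"
    using BA dom unfolding variable_curv_hom_model_def by fastforce
  obtain \<theta> where \<theta>: "tangent_isometry cone_manifold ?c q B \<theta>" "pulls_back_to cone_manifold ?c q A 0 \<theta> 1"
    using BA dom unfolding variable_curv_hom_model_def by fastforce
  obtain T where T: "linear T" "bij T" "\<And>v. \<theta> (T v) = \<phi> v"
    "\<And>v w. metric_form (metric cone_manifold ?c) (snd ?c q) (T v) (T w)
      = metric_form (metric cone_manifold ?c) (snd ?c p) v w"
    using tangent_isometry_transition[OF \<phi>(1) \<theta>(1)] by blast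
  have "(area (T x) (T y))\<^sup>2 = (area x y)\<^sup>2" for x y
  proof -
    have "A 0 (map \<phi> [x, y, x, y]) = area_tensor cone_factor [x, y, x, y]"
      using \<phi>(2)[unfolded pulls_back_to_def, rule_format, of "[x, y, x, y]"]
        nabla_curv_cone[OF dom(1), of "[x, y, x, y]" 0]
      by (simp del: nabla_curv.simps)
    moreover have "A 0 (map \<theta> (map T [x, y, x, y])) = area_tensor cone_factor (map T [x, y, x, y])"
      using \<theta>(2)[unfolded pulls_back_to_def, rule_format, of "map T [x, y, x, y]"]
        nabla_curv_cone[OF dom(2), of "map T [x, y, x, y]" 0]
      by (simp del: nabla_curv.simps)
    ultimately show ?thesis
      by (simp add: T(3) area_tensor_def power2_eq_square)
  qed
  then have "plane_sum q ^ 4 = plane_sum p ^ 4"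
    using cone_isometry_invariant[of T q p] T bij_is_surj[OF T(2)] by simp
  then show False by (simp add: s)
qed

section \<open>The metrics with \<open>f = h(x) y\<^sup>2 / 2\<close>\<close>

definition wave_metric :: "(real \<Rightarrow> real \<Rightarrow> real) \<Rightarrow> real^3 \<Rightarrow> real^3^3" where
  "wave_metric f p = vector [vector [- 2 * f (p $ 1) (p $ 2), 0, 1], vector [0, 1, 0], vector [1, 0, 0]]"

lemma Mf_eq: "Mf U f = chart_manifold U (wave_metric f)"
  by (simp add: Mf_def chart_manifold_def wave_metric_def[abs_def])

text \<open>The metric at points where f vanishes, used as the inner product of the model.\<close>

definition wave_form :: "real^3 \<Rightarrow> real^3 \<Rightarrow> real" where
  "wave_form v w = v $ 1 * w $ 3 + v $ 3 * w $ 1 + v $ 2 * w $ 2"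

lemma metric_form_wave:
  "metric_form (wave_metric f) p v w = wave_form v w - 2 * f (p $ 1) (p $ 2) * v $ 1 * w $ 1"
  by (simp add: metric_form_def wave_metric_def wave_form_def inner_vec_def sum_3
      matrix_vector_mult_def algebra_simps)

lemma wave_metric_nondegenerate:
  "transpose (wave_metric f p) = wave_metric f p" "invertible (wave_metric f p)"
  by (simp_all add: invertible_det_nz det_3 wave_metric_def transpose_def vec_eq_iff forall_3)

lemma nondegenerate_wave_form: "nondegenerate_inner_product wave_form"
  unfolding nondegenerate_inner_product_def
proof (intro conjI allI impI)
  show "bilinear wave_form"
    by (rule bilinear_coordinate_form) (simp_all add: wave_form_def algebra_simps)
  show "wave_form v w = wave_form w v" for v w
    by (simp add: wave_form_def algebra_simps)
  fix v assume v: "\<forall>w. wave_form v w = 0"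
  show "v = 0"
    using v[rule_format, of "axis 1 1"] v[rule_format, of "axis 2 1"] v[rule_format, of "axis 3 1"]
    by (intro vec3_eqI) (simp_all add: wave_form_def axis_component)
qed

lemma metric_form_wave_eq_zero:
  assumes "\<And>w. metric_form (wave_metric f) p v w = 0"
  shows "v = 0"
  using assms[of "axis 1 1"] assms[of "axis 2 1"] assms[of "axis 3 1"]
  by (intro vec3_eqI) (simp_all add: metric_form_wave wave_form_def axis_component)

definition wave_factor :: "(real^3) list \<Rightarrow> real" where
  "wave_factor zs = prod_list (map (\<lambda>x. x $ 1) zs)"

lemma wave_factor_simps [simp]:
  "wave_factor [] = 1" "wave_factor (x # zs) = x $ 1 * wave_factor zs"
  "wave_factor (ys @ zs) = wave_factor ys * wave_factor zs"
  by (simp_all add: wave_factor_def)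

lemma wave_factor_update:
  "s < length zs \<Longrightarrow> wave_factor (zs[s := x]) = x $ 1 * wave_factor (take s zs @ drop (Suc s) zs)"
  by (simp add: upd_conv_take_nth_drop)

lemma multilinear_wave_factor: "multilinear r (\<lambda>zs. c * wave_factor zs)"
  unfolding multilinear_def
  by (auto intro!: linearI simp: wave_factor_update algebra_simps simp del: wave_factor_simps)

text \<open>Both sides of the Ricci identity vanish: a product of first components is symmetric in
  all slots, and the values of \<open>H\<close> have first component 0.\<close>

lemma curvature_model_wave: "curvature_model k wave_form (\<lambda>i. area_tensor (\<lambda>zs. - wave_factor zs))"
proof (rule curvature_model_area_tensor[where H = "\<lambda>x. vector [0, x $ 1, - x $ 2]"])
  show "wave_form (vector [0, x $ 1, - x $ 2]) y = area x y"
    "area (vector [0, x $ 1, - x $ 2]) y + area x (vector [0, y $ 1, - y $ 2]) = 0" for x y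
    by (simp_all add: wave_form_def area_def algebra_simps)
  show "multilinear r (\<lambda>zs. - wave_factor zs)" for r
    using multilinear_wave_factor[of r "-1"] by simp
  show "\<exists>a b. \<forall>u. - wave_factor (u # zs) = u $ 1 * a + u $ 2 * b" for zs
    by (intro exI[of _ "- wave_factor zs"] exI[of _ 0]) simp
  show "- wave_factor (ys @ [u, v] @ zs) - - wave_factor (ys @ [v, u] @ zs)
    = (\<Sum>S\<in>Pow {..<length zs}. area u v * - wave_factor (nths zs S) *
       (\<Sum>s<length ys. - wave_factor (ys[s := vector [0, ys ! s $ 1, - ys ! s $ 2]] @ nths zs (- S))))"
    for ys u v zs
    by (simp add: wave_factor_update)
qed (rule nondegenerate_wave_form)

lemma component_has_derivative: "((\<lambda>p::real^3. p $ i) has_derivative (\<lambda>u. u $ i)) (at p)"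
  by (rule bounded_linear_imp_has_derivative) (rule bounded_linear_vec_nth)

context
  fixes h :: "nat \<Rightarrow> real \<Rightarrow> real"
begin

text \<open>The profile comes with all its derivatives as a sequence; \<open>h n\<close> is the n-th
  derivative of \<open>h 0\<close> once the later assumption on \<open>h\<close> is in
  force.\<close>

definition wave :: "real^3 \<Rightarrow> real^3^3" where
  "wave = wave_metric (\<lambda>x y. 1 / 2 * h 0 x * y\<^sup>2)"

definition wave_manifold :: "(real^3) set \<Rightarrow> (real^3, 3) pr_manifold" where
  "wave_manifold U = Mf U (\<lambda>x y. 1 / 2 * h 0 x * y\<^sup>2)"

lemma wave_manifold_eq: "wave_manifold U = chart_manifold U wave"
  by (simp add: wave_manifold_def Mf_eq wave_def)

text \<open>The differential of 2 f at \<open>p\<close>, applied to \<open>u\<close>.\<close>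

definition potential_deriv :: "real^3 \<Rightarrow> real^3 \<Rightarrow> real" where
  "potential_deriv p u = h 1 (p $ 1) * u $ 1 * (p $ 2)\<^sup>2 + 2 * h 0 (p $ 1) * p $ 2 * u $ 2"

definition wave_christoffel :: "real^3 \<Rightarrow> real^3 \<Rightarrow> real^3 \<Rightarrow> real^3" where
  "wave_christoffel p u v = vector [0, u $ 1 * v $ 1 * h 0 (p $ 1) * p $ 2,
     - (1 / 2) * h 1 (p $ 1) * (p $ 2)\<^sup>2 * u $ 1 * v $ 1
     - h 0 (p $ 1) * p $ 2 * (u $ 1 * v $ 2 + u $ 2 * v $ 1)]"

lemma metric_form_wave_h:
  "metric_form wave p v w = wave_form v w - h 0 (p $ 1) * (p $ 2)\<^sup>2 * v $ 1 * w $ 1"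
  by (simp add: wave_def metric_form_wave)

text \<open>The Koszul formula with the derivatives of the metric inserted; it will be evaluated
  both at a point and at its image under an isometry.\<close>

lemma wave_koszul:
  "2 * metric_form wave p (wave_christoffel p u v) w = - potential_deriv p u * v $ 1 * w $ 1
    - potential_deriv p v * u $ 1 * w $ 1 + potential_deriv p w * u $ 1 * v $ 1"
  by (simp add: metric_form_wave_h wave_form_def wave_christoffel_def potential_deriv_def algebra_simps)

text \<open>\<open>T\<close> preserves the kernel of dx, where the metric is the square of dy. Thus
  the second basis vector keeps its y-component up to sign, and the area changes by \<open>t\<close>
  up to sign.\<close>

lemma wave_isometry_area:
  assumes met: "\<And>v w. metric_form wave q (T v) (T w) = metric_form wave p v w"
    and t: "\<And>v. T v $ 1 = t * v $ 1"
  shows "(area (T (axis 1 1)) (T (axis 2 1)))\<^sup>2 = t\<^sup>2"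
proof -
  have "T (axis 2 1) $ 1 = 0" "T (axis 1 1) $ 1 = t" using t by (simp_all add: axis_component)
  moreover have "(T (axis 2 1) $ 2)\<^sup>2 = 1"
    using met[of "axis 2 1" "axis 2 1"] calculation(1)
    by (simp add: metric_form_wave_h wave_form_def axis_component power2_eq_square)
  ultimately show ?thesis by (simp add: area_def power_mult_distrib)
qed

context
  assumes h: "\<And>n x. (h n has_real_derivative h (Suc n) x) (at x)"
begin

lemma h_has_derivative:
  "(g has_derivative g') (at p) \<Longrightarrow> ((\<lambda>q. h n (g q)) has_derivative (\<lambda>u. h (Suc n) (g p) * g' u)) (at p)"
  using has_derivative_compose[OF _ h[unfolded has_field_derivative_def]] by blast

lemma metric_form_wave_dir_deriv:
  "dir_deriv (\<lambda>q. metric_form wave q v w) p u = - potential_deriv p u * v $ 1 * w $ 1"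
  unfolding metric_form_wave_h
  by (rule dir_deriv_eq, rule has_derivative_eq_rhs)
    (auto intro!: derivative_eq_intros h_has_derivative component_has_derivative
      simp: potential_deriv_def algebra_simps fun_eq_iff)

lemma christoffel_wave: "christoffel wave p u v = wave_christoffel p u v"
proof (rule christoffel_eqI)
  show "invertible (wave p)" unfolding wave_def by (rule wave_metric_nondegenerate)
  have "\<forall>i. (wave p *v wave_christoffel p u v) $ i =
         (dir_deriv (\<lambda>q. metric_form wave q v (axis i 1)) p u
           + dir_deriv (\<lambda>q. metric_form wave q u (axis i 1)) p v
           - dir_deriv (\<lambda>q. metric_form wave q u v) p (axis i 1)) / 2"
    unfolding metric_form_wave_dir_deriv forall_3
    by (simp add: matrix_vector_mult_def sum_3 wave_def wave_metric_def wave_christoffel_def axis_component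
        potential_deriv_def field_simps)
  then show "(wave p *v wave_christoffel p u v) $ i =
         (dir_deriv (\<lambda>q. metric_form wave q v (axis i 1)) p u
           + dir_deriv (\<lambda>q. metric_form wave q u (axis i 1)) p v
           - dir_deriv (\<lambda>q. metric_form wave q u v) p (axis i 1)) / 2" for i
    by blast
qed

text \<open>On antisymmetrising in \<open>u\<close> and \<open>v\<close>, the quadratic terms and
  all terms with derivatives of \<open>h 0\<close> cancel; what remains comes from differentiating
  the factor y.\<close>

lemma curv_endo_wave:
  "curv_endo wave p u v w = (- h 0 (p $ 1) * area u v) *\<^sub>R vector [0, w $ 1, - w $ 2]"
proof -
  have D: "dir_deriv (\<lambda>q. christoffel wave q v w) p u =
      (h 1 (p $ 1) * u $ 1 * p $ 2 + h 0 (p $ 1) * u $ 2) *\<^sub>R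
        vector [0, v $ 1 * w $ 1, - (v $ 1 * w $ 2 + v $ 2 * w $ 1)]
      + (h 2 (p $ 1) * u $ 1 * (p $ 2)\<^sup>2 + 2 * h 1 (p $ 1) * p $ 2 * u $ 2) *\<^sub>R
        vector [0, 0, - (v $ 1 * w $ 1 / 2)]" for u v w
  proof -
    have "christoffel wave q v w = (h 0 (q $ 1) * q $ 2) *\<^sub>R
        vector [0, v $ 1 * w $ 1, - (v $ 1 * w $ 2 + v $ 2 * w $ 1)]
      + (h 1 (q $ 1) * (q $ 2)\<^sup>2) *\<^sub>R vector [0, 0, - (v $ 1 * w $ 1 / 2)]" for q
      unfolding christoffel_wave
      by (rule vec3_eqI) (simp_all add: wave_christoffel_def algebra_simps)
    then show ?thesis
      by (simp only:) (rule dir_deriv_eq, rule has_derivative_eq_rhs,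
        auto intro!: derivative_eq_intros h_has_derivative component_has_derivative
          simp: algebra_simps fun_eq_iff numeral_2_eq_2)
  qed
  show ?thesis
    unfolding curv_endo_def D unfolding christoffel_wave
    by (rule vec3_eqI)
      (simp_all add: wave_christoffel_def area_def algebra_simps power2_eq_square)
qed

lemma nabla_curv_wave:
  "length vs = 4 + l \<Longrightarrow> nabla_curv wave l p vs = - h l (p $ 1) * area_tensor wave_factor vs"
proof (induction l arbitrary: p vs)
  case 0
  then show ?case
    by (simp add: metric_form_wave_h wave_form_def curv_endo_wave area_tensor_def area_def
        algebra_simps)
next
  case (Suc l)
  obtain X w where X: "vs = X @ [w]" "length X = 4 + l"
    using Suc.prems
    by (metis add_Suc_right append_butlast_last_id length_append_singleton length_0_conv nat.simps(3) nat.inject)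
  obtain x y z v ys where ys: "X = [x, y, z, v] @ ys" "length ys = l"
    using list_4_append X(2) by blast
  have "dir_deriv (\<lambda>q. nabla_curv wave l q X) p w
      = dir_deriv (\<lambda>q. h l (q $ 1) * - area_tensor wave_factor X) p w"
    using Suc.IH X(2) by simp
  also have "\<dots> = w $ 1 * h (Suc l) (p $ 1) * - area_tensor wave_factor X"
    by (rule dir_deriv_compose(2)[OF bounded_linear_vec_nth h])
  finally have D: "dir_deriv (\<lambda>q. nabla_curv wave l q X) p w
      = w $ 1 * h (Suc l) (p $ 1) * - area_tensor wave_factor X" .
  \<comment> \<open>Christoffel endomorphisms are trace-free on the plane and have values with first
    component 0, so the connection terms in the covariant derivative vanish.\<close>
  have tr: "area (wave_christoffel p w x) y + area x (wave_christoffel p w y) = 0 * area x y" for x y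
    by (simp add: wave_christoffel_def area_def algebra_simps)
  have "(\<Sum>t<4 + l. nabla_curv wave l p (X[t := christoffel wave p w (X ! t)]))
      = - h l (p $ 1) * (\<Sum>t<4 + l. area_tensor wave_factor (X[t := wave_christoffel p w (X ! t)]))"
    unfolding sum_distrib_left christoffel_wave by (intro sum.cong) (use Suc.IH X(2) in auto)
  also have "(\<Sum>t<4 + l. area_tensor wave_factor (X[t := wave_christoffel p w (X ! t)]))
      = area x y * area z v * (\<Sum>s<l. wave_factor (ys[s := wave_christoffel p w (ys ! s)]))"
    using area_tensor_derivation[where N = "wave_christoffel p w" and \<tau> = 0 and P = wave_factor and
        ys = ys and x = x and y = y and z = z and w = v and zs = "[]", OF tr]
    by (simp only: ys append_Nil2) simp
  also have "\<dots> = 0"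
    using ys(2) by (simp add: wave_factor_update wave_christoffel_def)
  finally have S: "(\<Sum>t<4 + l. nabla_curv wave l p (X[t := christoffel wave p w (X ! t)])) = 0"
    by simp
  have "nabla_curv wave (Suc l) p vs
      = dir_deriv (\<lambda>q. nabla_curv wave l q X) p w
      - (\<Sum>t<4 + l. nabla_curv wave l p (X[t := christoffel wave p w (X ! t)]))"
    using X by (simp add: nth_append)
  then show ?case
    unfolding D S by (simp add: X ys)
qed

text \<open>A boost by \<open>a\<close> multiplies the \<open>l\<close>-th derivative of the curvature by \<open>a\<^bsup>2+l\<^esup>\<close>.\<close>

lemma variable_curv_hom_wave:
  assumes pos: "\<And>l p. l \<le> k \<Longrightarrow> p \<in> U \<Longrightarrow> h l (p $ 1) > 0"
  shows "variable_curv_hom k (wave_manifold U)"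
  unfolding variable_curv_hom_def
proof (intro exI conjI)
  show "curvature_model k wave_form (\<lambda>i. area_tensor (\<lambda>zs. - wave_factor zs))"
    by (rule curvature_model_wave)
  have "\<exists>\<phi>. tangent_isometry (wave_manifold U) (U, \<lambda>p. p) p wave_form \<phi> \<and>
       pulls_back_to (wave_manifold U) (U, \<lambda>p. p) p (\<lambda>i. area_tensor (\<lambda>zs. - wave_factor zs)) l \<phi> 1"
    if p: "p \<in> U" "l \<le> k" for p l
  proof (intro exI conjI)
    \<comment> \<open>The boost parameter with \<open>a^(2+l) = h l (p $ 1)\<close>; positivity
      provides the root also for even \<open>2 + l\<close>.\<close>
    define a where "a = root (2 + l) (h l (p $ 1))"
    have a: "a > 0" "a ^ (2 + l) = h l (p $ 1)"
      using pos[OF p(2,1)] real_root_pow_pos[of "2 + l" "h l (p $ 1)"]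
        real_root_gt_zero[of "2 + l" "h l (p $ 1)"] unfolding a_def by auto
    \<comment> \<open>\<open>c\<close> is the value of f at \<open>p\<close>; the shear by
      \<open>c\<close> removes the coefficient -2 f from the metric.\<close>
    define c where "c = 1 / 2 * h 0 (p $ 1) * (p $ 2)\<^sup>2"
    let ?\<phi> = "\<lambda>x::real^3. vector [a * x $ 1, x $ 2, (x $ 3 - c * x $ 1) / a] :: real^3"
    have "linear ?\<phi>"
      by (rule linearI; rule vec3_eqI) (simp_all add: algebra_simps add_divide_distrib diff_divide_distrib)
    moreover have "bij ?\<phi>"
      by (rule o_bij[where g = "\<lambda>x::real^3. vector [x $ 1 / a, x $ 2, a * x $ 3 + c * x $ 1 / a]"])
        (use a in \<open>auto intro!: ext vec3_eqI\<close>)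
    moreover have "wave_form (?\<phi> v) (?\<phi> w) = metric_form wave p v w" for v w
      using a by (simp add: metric_form_wave_h wave_form_def c_def field_simps)
    ultimately show "tangent_isometry (wave_manifold U) (U, \<lambda>p. p) p wave_form ?\<phi>"
      by (simp add: tangent_isometry_def wave_manifold_eq)
    show "pulls_back_to (wave_manifold U) (U, \<lambda>p. p) p (\<lambda>i. area_tensor (\<lambda>zs. - wave_factor zs)) l ?\<phi> 1"
      unfolding pulls_back_to_def
    proof (intro allI impI)
      fix vs :: "(real^3) list" assume vs: "length vs = 4 + l"
      obtain x y z v ys where ys: "vs = [x, y, z, v] @ ys" "length ys = l"
        using list_4_append vs by blast
      have ar: "area (?\<phi> x) (?\<phi> y) = a * area x y" for x y
        by (simp add: area_def algebra_simps)
      have w: "wave_factor (map ?\<phi> ys) = a ^ length ys * wave_factor ys" for ys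
        by (induction ys) simp_all
      have "area_tensor (\<lambda>zs. - wave_factor zs) (map ?\<phi> vs)
        = - (a ^ (2 + l) * area_tensor wave_factor vs)"
        by (simp add: ys ar w power_add power2_eq_square)
      then show "area_tensor (\<lambda>zs. - wave_factor zs) (map ?\<phi> vs) = 1 *
        nabla_curv (metric (wave_manifold U) (U, \<lambda>p. p)) l (snd (U, \<lambda>p. p) p) vs"
        using vs a(2) by (simp add: nabla_curv_wave wave_manifold_eq)
    qed
  qed
  then show "variable_curv_hom_model k (wave_manifold U) wave_form
      (\<lambda>i. area_tensor (\<lambda>zs. - wave_factor zs))"
    by (simp add: variable_curv_hom_model_def wave_manifold_eq)
qed

section \<open>Obstructions to homogeneity of the waves\<close>

definition test_vectors :: "nat \<Rightarrow> (real^3) list" where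
  "test_vectors l = [axis 1 1, axis 2 1, axis 1 1, axis 2 1] @ replicate l (axis 1 1)"

lemma test_vectors: "length (test_vectors l) = 4 + l" "area_tensor wave_factor (test_vectors l) = 1"
proof -
  have "wave_factor (replicate l (axis 1 1)) = 1"
    by (induction l) (simp_all add: axis_component)
  then show "area_tensor wave_factor (test_vectors l) = 1"
    by (simp add: test_vectors_def area_def axis_component)
qed (simp add: test_vectors_def)

text \<open>No linear isomorphism identifies a vanishing tensor with a nonvanishing one, so level
  \<open>k\<close> alone gives the contradiction.\<close>

lemma not_variable_curv_hom_wave:
  assumes "p \<in> U" "q \<in> U" "h k (p $ 1) \<noteq> 0" "h k (q $ 1) = 0"
  shows "\<not> variable_curv_hom k (wave_manifold U)"
proof
  assume "variable_curv_hom k (wave_manifold U)"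
  then obtain B :: "real^3 \<Rightarrow> real^3 \<Rightarrow> real" and A
    where BA: "variable_curv_hom_model k (wave_manifold U) B A"
    by (auto simp: variable_curv_hom_def)
  let ?c = "(U, \<lambda>p. p) :: (real^3) set \<times> (real^3 \<Rightarrow> real^3)"
  have ex: "\<exists>\<phi>. tangent_isometry (wave_manifold U) ?c p B \<phi> \<and>
      pulls_back_to (wave_manifold U) ?c p A k \<phi> 1" if "p \<in> U" for p
    using BA that by (simp add: variable_curv_hom_model_def wave_manifold_eq)
  obtain \<phi> where \<phi>: "tangent_isometry (wave_manifold U) ?c p B \<phi>"
    "pulls_back_to (wave_manifold U) ?c p A k \<phi> 1"
    using ex[OF assms(1)] by blast
  obtain \<theta> where \<theta>: "tangent_isometry (wave_manifold U) ?c q B \<theta>"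
    "pulls_back_to (wave_manifold U) ?c q A k \<theta> 1"
    using ex[OF assms(2)] by blast
  obtain T where T: "\<And>v. \<theta> (T v) = \<phi> v"
    using tangent_isometry_transition[OF \<phi>(1) \<theta>(1)] by metis
  let ?vs = "test_vectors k"
  have "A k (map \<phi> ?vs) = - h k (p $ 1)"
    using \<phi>(2)[unfolded pulls_back_to_def, rule_format, of ?vs] test_vectors[of k]
    by (simp add: nabla_curv_wave wave_manifold_eq)
  moreover have "A k (map \<theta> (map T ?vs)) = 0"
    using \<theta>(2)[unfolded pulls_back_to_def, rule_format, of "map T ?vs"] test_vectors(1)[of k] assms(4)
    by (simp add: nabla_curv_wave wave_manifold_eq)
  ultimately show False
    using assms(3) T by (simp add: comp_def)
qed

text \<open>Where \<open>h 0\<close> and \<open>h 1\<close> agree, levels 0 and 1 involve a single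
  number, \<open>P\<close> at \<open>p\<close> and \<open>Q\<close> at \<open>q\<close>. Dividing
  level 1 by level 0 shows that \<open>T\<close> multiplies dx by the ratio of the homothety
  factors. By \<open>wave_isometry_area\<close> this ratio then cancels from level 0, leaving
  \<open>P = Q\<close>.\<close>

lemma not_homothety_curv_hom_wave:
  assumes "p \<in> U" "q \<in> U" "h 0 (p $ 1) = h 1 (p $ 1)" "h 0 (q $ 1) = h 1 (q $ 1)"
    "0 < h 0 (p $ 1)" "0 < h 0 (q $ 1)" "h 0 (p $ 1) \<noteq> h 0 (q $ 1)" "1 \<le> k"
  shows "\<not> homothety_curv_hom k (wave_manifold U)"
proof
  assume "homothety_curv_hom k (wave_manifold U)"
  then obtain B :: "real^3 \<Rightarrow> real^3 \<Rightarrow> real" and A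
    where BA: "homothety_curv_hom_model k (wave_manifold U) B A"
    by (auto simp: homothety_curv_hom_def)
  let ?c = "(U, \<lambda>p. p) :: (real^3) set \<times> (real^3 \<Rightarrow> real^3)"
  have ex: "\<exists>\<phi> \<mu>. tangent_isometry (wave_manifold U) ?c p B \<phi> \<and> \<mu> \<noteq> 0 \<and>
      pulls_back_to (wave_manifold U) ?c p A 0 \<phi> (\<mu>\<^sup>2) \<and>
      pulls_back_to (wave_manifold U) ?c p A 1 \<phi> (\<mu> ^ 3)" if p: "p \<in> U" for p
  proof -
    obtain \<phi> \<mu> where "tangent_isometry (wave_manifold U) ?c p B \<phi>" "\<mu> \<noteq> 0"
      "\<And>l. l \<le> k \<Longrightarrow> pulls_back_to (wave_manifold U) ?c p A l \<phi> (\<mu> ^ (2 + l))"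
      using BA p by (auto simp: homothety_curv_hom_model_def wave_manifold_eq)
    from this(1,2) this(3)[of 0] this(3)[of 1] assms(8) show ?thesis
      by (intro exI[of _ \<phi>] exI[of _ \<mu>]) (simp add: numeral_3_eq_3 numeral_2_eq_2)
  qed
  obtain \<phi> \<kappa> where \<phi>: "tangent_isometry (wave_manifold U) ?c p B \<phi>" "\<kappa> \<noteq> 0"
    "pulls_back_to (wave_manifold U) ?c p A 0 \<phi> (\<kappa>\<^sup>2)" "pulls_back_to (wave_manifold U) ?c p A 1 \<phi> (\<kappa> ^ 3)"
    using ex[OF assms(1)] by blast
  obtain \<theta> \<mu> where \<theta>: "tangent_isometry (wave_manifold U) ?c q B \<theta>" "\<mu> \<noteq> 0"
    "pulls_back_to (wave_manifold U) ?c q A 0 \<theta> (\<mu>\<^sup>2)" "pulls_back_to (wave_manifold U) ?c q A 1 \<theta> (\<mu> ^ 3)"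
    using ex[OF assms(2)] by blast
  obtain T where T: "\<And>v. \<theta> (T v) = \<phi> v"
    "\<And>v w. metric_form (metric (wave_manifold U) ?c) (snd ?c q) (T v) (T w)
      = metric_form (metric (wave_manifold U) ?c) (snd ?c p) v w"
    using tangent_isometry_transition[OF \<phi>(1) \<theta>(1)] by metis
  define P Q where "P = h 0 (p $ 1)" and "Q = h 0 (q $ 1)"
  define \<omega> where "\<omega> = (area (T (axis 1 1)) (T (axis 2 1)))\<^sup>2"
  let ?e = "test_vectors 0"
  have "\<kappa>\<^sup>2 * P = \<mu>\<^sup>2 * Q * \<omega>"
  proof -
    have "A 0 (map \<phi> ?e) = - (\<kappa>\<^sup>2 * P)"
      using \<phi>(3)[unfolded pulls_back_to_def, rule_format, of ?e] test_vectors[of 0]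
      by (simp add: nabla_curv_wave wave_manifold_eq P_def del: nabla_curv.simps)
    moreover have "A 0 (map \<theta> (map T ?e)) = - (\<mu>\<^sup>2 * Q * \<omega>)"
      using \<theta>(3)[unfolded pulls_back_to_def, rule_format, of "map T ?e"]
      by (simp add: nabla_curv_wave wave_manifold_eq Q_def \<omega>_def test_vectors_def power2_eq_square
          del: nabla_curv.simps)
    ultimately show ?thesis by (simp add: T(1) comp_def)
  qed
  note eq0 = this
  have eq1: "\<kappa> ^ 3 * P * z $ 1 = \<mu> ^ 3 * Q * \<omega> * T z $ 1" for z
  proof -
    have "A 1 (map \<phi> (?e @ [z])) = - (\<kappa> ^ 3 * P * z $ 1)"
      using \<phi>(4)[unfolded pulls_back_to_def, rule_format, of "?e @ [z]"] test_vectors[of 0] assms(3)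
      by (simp add: nabla_curv_wave wave_manifold_eq P_def test_vectors_def area_def axis_component
          del: nabla_curv.simps)
    moreover have "A 1 (map \<theta> (map T (?e @ [z]))) = - (\<mu> ^ 3 * Q * \<omega> * T z $ 1)"
      using \<theta>(4)[unfolded pulls_back_to_def, rule_format, of "map T (?e @ [z])"] assms(4)
      by (simp add: nabla_curv_wave wave_manifold_eq Q_def \<omega>_def test_vectors_def power2_eq_square
          del: nabla_curv.simps)
    ultimately show ?thesis by (simp add: T(1) comp_def)
  qed
  have PQ: "P > 0" "Q > 0" "P \<noteq> Q" using assms by (simp_all add: P_def Q_def)
  have "T z $ 1 = \<kappa> / \<mu> * z $ 1" for z
  proof -
    have "\<kappa>\<^sup>2 * P * (\<kappa> * z $ 1) = \<kappa> ^ 3 * P * z $ 1"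
      by (simp add: power2_eq_square power3_eq_cube)
    also have "\<dots> = (\<mu>\<^sup>2 * Q * \<omega>) * (\<mu> * T z $ 1)"
      unfolding eq1 by (simp add: power2_eq_square power3_eq_cube)
    finally have "\<kappa>\<^sup>2 * P * (\<kappa> * z $ 1) = \<kappa>\<^sup>2 * P * (\<mu> * T z $ 1)"
      by (simp only: eq0)
    then show ?thesis using \<phi>(2) \<theta>(2) PQ by (simp add: field_simps)
  qed
  then have "\<omega> = (\<kappa> / \<mu>)\<^sup>2"
    unfolding \<omega>_def using T(2) by (intro wave_isometry_area) (simp_all add: wave_manifold_eq)
  then have "\<kappa>\<^sup>2 * P = \<kappa>\<^sup>2 * Q"
    using eq0 \<theta>(2) by (simp add: power_divide)
  then show False using \<phi>(2) PQ by simp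
qed

end

end

section \<open>Local isometries for \<open>h = exp\<close>\<close>

lemma has_derivative_component:
  fixes f :: "'a::real_normed_vector \<Rightarrow> real^'n"
  assumes "f differentiable (at p)"
  shows "((\<lambda>q. f q $ i) has_derivative (\<lambda>u. dir_deriv f p u $ i)) (at p)"
  using bounded_linear.has_derivative[OF bounded_linear_vec_nth] assms
  by (simp add: frechet_derivative_works)

text \<open>Allows an identity on an open set to be differentiated, which turns relations between
  derivatives of an isometry into relations one order higher.\<close>

lemma has_derivative_eq_on_open:
  assumes "open U" "p \<in> U" "\<And>q. q \<in> U \<Longrightarrow> f q = g q"
    and "(f has_derivative f') (at p)" "(g has_derivative g') (at p)"
  shows "f' u = g' u"
proof -
  have "f' u = dir_deriv f p u" by (simp add: dir_deriv_eq[OF assms(4)])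
  also have "\<dots> = dir_deriv g p u" by (rule dir_deriv_cong_open[OF assms(1-3)])
  also have "\<dots> = g' u" by (rule dir_deriv_eq[OF assms(5)])
  finally show ?thesis .
qed

lemma dir_deriv_commute_vec:
  fixes f :: "'a::real_normed_vector \<Rightarrow> real^'n"
  assumes U: "open U" "p \<in> U" and f: "smooth_on U f"
  shows "dir_deriv (\<lambda>q. dir_deriv f q u) p v = dir_deriv (\<lambda>q. dir_deriv f q v) p u"
  unfolding vec_eq_iff
proof
  fix i
  have d: "f differentiable (at q)" if "q \<in> U" for q
    using smooth_on_differentiable[OF f that] .
  have d': "(\<lambda>q. dir_deriv f q w) differentiable (at p)" for w
    using smooth_on_differentiable[OF smooth_on_dir_deriv[OF f] U(2)] .
  define F where "F q = f q $ i" for q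
  have dF: "dir_deriv F q w = dir_deriv f q w $ i" if "q \<in> U" for q w
    unfolding F_def by (rule dir_deriv_eq) (rule has_derivative_component[OF d[OF that]])
  have dF': "((\<lambda>q. dir_deriv F q w) has_derivative (\<lambda>v. dir_deriv (\<lambda>q. dir_deriv f q w) p v $ i)) (at p)" for w
    by (rule has_derivative_transform_within_open[OF has_derivative_component[OF d'] U])
      (simp add: dF)
  have "dir_deriv (\<lambda>q. dir_deriv F q u) p v = dir_deriv (\<lambda>q. dir_deriv F q v) p u"
  proof (rule dir_deriv_commute[OF U])
    show "F differentiable (at q)" if "q \<in> U" for q
      using has_derivative_component[OF d[OF that], of i]
      unfolding F_def differentiable_def by blast
  qed (use dF' in \<open>auto simp: differentiable_def\<close>)
  then show "dir_deriv (\<lambda>q. dir_deriv f q u) p v $ i = dir_deriv (\<lambda>q. dir_deriv f q v) p u $ i"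
    by (simp add: dir_deriv_eq[OF dF'])
qed

context
  fixes h :: "nat \<Rightarrow> real \<Rightarrow> real"
  assumes h: "\<And>n x. (h n has_real_derivative h (Suc n) x) (at x)"
begin

context
  fixes U :: "(real^3) set" and \<psi> :: "real^3 \<Rightarrow> real^3"
  assumes U: "open U" and smooth: "smooth_on U \<psi>"
    and iso: "\<And>p v w. p \<in> U \<Longrightarrow> metric_form (wave h) p v w =
      metric_form (wave h) (\<psi> p) (dir_deriv \<psi> p v) (dir_deriv \<psi> p w)"
begin

lemma isometry_has_derivative:
  assumes "p \<in> U"
  shows "((\<lambda>q. \<psi> q $ i) has_derivative (\<lambda>u. dir_deriv \<psi> p u $ i)) (at p)"
    and "((\<lambda>q. dir_deriv \<psi> q v $ i) has_derivative
      (\<lambda>u. dir_deriv (\<lambda>q. dir_deriv \<psi> q v) p u $ i)) (at p)"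
    and "linear (dir_deriv \<psi> p)"
  using assms smooth_on_differentiable[OF smooth] smooth_on_differentiable[OF smooth_on_dir_deriv[OF smooth]]
  by (auto intro!: has_derivative_component linear_frechet_derivative)

text \<open>Both sides are Levi-Civita connections of the same metric: subtract the Koszul formulas.\<close>

lemma isometry_second_derivative:
  assumes p: "p \<in> U"
  shows "dir_deriv (\<lambda>q. dir_deriv \<psi> q v) p u = dir_deriv \<psi> p (wave_christoffel h p u v)
    - wave_christoffel h (\<psi> p) (dir_deriv \<psi> p u) (dir_deriv \<psi> p v)"
proof -
  define a where "a v q = dir_deriv \<psi> q v" for v q
  define S where "S u v = dir_deriv (a v) p u" for u v
  define m where "m = metric_form (wave h) (\<psi> p)"
  have sym: "S u v = S v u" for u v
    unfolding S_def a_def by (rule dir_deriv_commute_vec[OF U p smooth])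
  have lin: "linear (\<lambda>v. a v p)"
    unfolding a_def by (rule isometry_has_derivative(3)[OF p])
  have m: "m (x - y) z = m x z - m y z" "m x y = m y x" for x y z
    by (simp_all add: m_def metric_form_wave_h wave_form_def algebra_simps)
  \<comment> \<open>The isometry equation, differentiated in the direction \<open>u\<close>.\<close>
  have E: "- potential_deriv h p u * v $ 1 * w $ 1 = m (S u v) (a w p) + m (a v p) (S u w)
      - potential_deriv h (\<psi> p) (a u p) * a v p $ 1 * a w p $ 1" for u v w
  proof -
    have "- potential_deriv h p u * v $ 1 * w $ 1 = dir_deriv (\<lambda>q. metric_form (wave h) q v w) p u"
      by (simp add: metric_form_wave_dir_deriv[where h = h, OF h])
    also have "\<dots> = dir_deriv (\<lambda>q. metric_form (wave h) (\<psi> q) (a v q) (a w q)) p u"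
      by (rule dir_deriv_cong_open[OF U p]) (simp add: a_def iso)
    also have "\<dots> = m (S u v) (a w p) + m (a v p) (S u w)
      - potential_deriv h (\<psi> p) (a u p) * a v p $ 1 * a w p $ 1"
      unfolding metric_form_wave_h wave_form_def m_def S_def a_def
      by (rule dir_deriv_eq, rule has_derivative_eq_rhs)
        (auto intro!: derivative_eq_intros h_has_derivative[where h = h, OF h] isometry_has_derivative[OF p] p
          simp: potential_deriv_def algebra_simps fun_eq_iff)
    finally show ?thesis .
  qed
  have K: "2 * m (a (wave_christoffel h p u v) p) (a w p) = - potential_deriv h p u * v $ 1 * w $ 1
    - potential_deriv h p v * u $ 1 * w $ 1 + potential_deriv h p w * u $ 1 * v $ 1" for w
    unfolding m_def a_def iso[OF p, symmetric] by (rule wave_koszul)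
  define \<Delta> where "\<Delta> = a (wave_christoffel h p u v) p - wave_christoffel h (\<psi> p) (a u p) (a v p) - S u v"
  \<comment> \<open>The Koszul combination: \<open>E\<close> for u, v, w plus \<open>E\<close> for
    v, u, w minus \<open>E\<close> for w, u, v isolates twice \<open>m (S u v) (a w p)\<close>, by
    the symmetry of \<open>S\<close>.\<close>
  have "m \<Delta> (a w p) = 0" for w
    using E[of u v w] E[of v u w] E[of w u v] K[of w]
      wave_koszul[of h "\<psi> p" "a u p" "a v p" "a w p", folded m_def]
      sym[of u v] sym[of u w] sym[of v w] m(2)[of "a u p" "S v w"] m(2)[of "a v p" "S u w"]
      m(2)[of "a v p" "S w u"]
    unfolding \<Delta>_def m(1) by (simp add: mult_ac)
  \<comment> \<open>The vectors \<open>a w p\<close> exhaust the tangent space since an isometry has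
    injective differential; nondegeneracy then gives \<open>\<Delta> = 0\<close>.\<close>
  moreover have "surj (\<lambda>v. a v p)"
  proof (rule linear_injective_imp_surjective[OF lin])
    have "v = 0" if "a v p = 0" for v
    proof (rule metric_form_wave_eq_zero)
      show "metric_form (wave_metric (\<lambda>x y. 1 / 2 * h 0 x * y\<^sup>2)) p v w = 0" for w
        using iso[OF p, of v w] that
        by (simp add: a_def wave_def metric_form_wave wave_form_def)
    qed
    then show "inj (\<lambda>v. a v p)" using linear_injective_0[OF lin] by blast
  qed (rule refl)
  ultimately have "metric_form (wave_metric (\<lambda>x y. 1 / 2 * h 0 x * y\<^sup>2)) (\<psi> p) \<Delta> x = 0" for x
    unfolding m_def wave_def by (metis surjD)
  then have "\<Delta> = 0" by (rule metric_form_wave_eq_zero)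
  then show ?thesis by (simp add: \<Delta>_def S_def a_def[abs_def] algebra_simps)
qed

lemma wave_christoffel_axis:
  "wave_christoffel h q (axis 1 1) (axis 1 1) =
    (h 0 (q $ 1) * q $ 2) *\<^sub>R axis 2 1 - (1 / 2 * h 1 (q $ 1) * (q $ 2)\<^sup>2) *\<^sub>R axis 3 1"
  "wave_christoffel h q (axis 1 1) (axis 2 1) = - (h 0 (q $ 1) * q $ 2) *\<^sub>R axis 3 1"
  "wave_christoffel h q (axis 2 1) (axis 1 1) = - (h 0 (q $ 1) * q $ 2) *\<^sub>R axis 3 1"
  "wave_christoffel h q (axis 2 1) (axis 2 1) = 0"
  "wave_christoffel h q u (axis 3 1) = 0"
  by (rule vec3_eqI; simp add: wave_christoffel_def axis_component)+

text \<open>Let \<open>X\<close> and \<open>Y\<close> be the first two components of \<open>\<psi>\<close>. Equality of the mixed derivatives of \<open>\<partial>\<^sub>xX\<close>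
  and of \<open>\<partial>\<^sub>xY\<close> gives first that \<open>X\<close> depends on \<open>x\<close> only, with \<open>X'' = 0\<close>, and then that
  \<open>exp x = X'\<^sup>2 exp X\<close>; differentiating once more yields \<open>X' = 1\<close>.\<close>

lemma exponential_isometry_fixes_x:
  assumes exp: "h = (\<lambda>n. exp)" and p: "p \<in> U"
  shows "\<psi> p $ 1 = p $ 1"
proof -
  define a where "a i q = dir_deriv \<psi> q (axis i 1)" for i q
  define S where "S q u i = dir_deriv (a i) q u" for q u i
  define X where "X i q = a i q $ 1" for i q
  define Y where "Y i q = a i q $ 2" for i q
  have dX: "((X i) has_derivative (\<lambda>u. S q u i $ 1)) (at q)"
    and dY: "((Y i) has_derivative (\<lambda>u. S q u i $ 2)) (at q)" if "q \<in> U" for q i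
    unfolding X_def Y_def S_def a_def using isometry_has_derivative(2)[OF that] by auto
  have d\<psi>: "((\<lambda>q. \<psi> q $ i) has_derivative (\<lambda>u. dir_deriv \<psi> q u $ i)) (at q)" if "q \<in> U" for q i
    using isometry_has_derivative(1)[OF that] .
  have dS: "((\<lambda>q. S q u i $ j) has_derivative (\<lambda>v. dir_deriv (\<lambda>q. S q u i) q v $ j)) (at q)"
    if "q \<in> U" for q u i j
    unfolding S_def a_def
    by (intro has_derivative_component smooth_on_differentiable[OF _ that] smooth_on_dir_deriv smooth)
  have commute: "dir_deriv (\<lambda>q. S q u i) q v = dir_deriv (\<lambda>q. S q v i) q u"
    if "q \<in> U" for q u v i
    unfolding S_def a_def
    by (rule dir_deriv_commute_vec[OF U that smooth_on_dir_deriv[OF smooth]])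
  have Seq: "S q (axis j 1) i = dir_deriv \<psi> q (wave_christoffel h q (axis j 1) (axis i 1))
    - wave_christoffel h (\<psi> q) (a j q) (a i q)" if "q \<in> U" for q i j
    unfolding S_def a_def by (rule isometry_second_derivative[OF that])
  have S11: "S q (axis 1 1) 1 = (exp (q $ 1) * q $ 2) *\<^sub>R a 2 q
      - (1 / 2 * exp (q $ 1) * (q $ 2)\<^sup>2) *\<^sub>R a 3 q - wave_christoffel h (\<psi> q) (a 1 q) (a 1 q)"
    and S12: "S q (axis 1 1) 2 = - (exp (q $ 1) * q $ 2) *\<^sub>R a 3 q - wave_christoffel h (\<psi> q) (a 1 q) (a 2 q)"
    and S21: "S q (axis 2 1) 1 = - (exp (q $ 1) * q $ 2) *\<^sub>R a 3 q - wave_christoffel h (\<psi> q) (a 2 q) (a 1 q)"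
    and S22: "S q (axis 2 1) 2 = - wave_christoffel h (\<psi> q) (a 2 q) (a 2 q)"
    and S3: "S q (axis j 1) 3 = - wave_christoffel h (\<psi> q) (a j q) (a 3 q)"
    if "q \<in> U" for q j
    unfolding Seq[OF that] wave_christoffel_axis unfolding exp a_def
    using isometry_has_derivative(3)[OF that]
    by (simp_all add: linear_diff linear_scale linear_neg linear_0)
  note Svals = S11 S12 S21 S22 S3
  \<comment> \<open>The two orders of differentiating \<open>X 1\<close> in x and y differ by
    \<open>exp (q $ 1) * X 2 q\<close>, which must therefore vanish.\<close>
  have X2: "X 2 q = 0" if q: "q \<in> U" for q
  proof -
    have "dir_deriv (\<lambda>q. S q (axis 1 1) 1) q (axis 2 1) $ 1 = exp (q $ 1) * X 2 q - exp (q $ 1) * q $ 2 * X 3 q"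
    proof -
      have "((\<lambda>q. exp (q $ 1) * q $ 2 * X 2 q - 1 / 2 * exp (q $ 1) * (q $ 2)\<^sup>2 * X 3 q)
        has_derivative (\<lambda>u. exp (q $ 1) * u $ 1 * q $ 2 * X 2 q + exp (q $ 1) * u $ 2 * X 2 q
          + exp (q $ 1) * q $ 2 * S q u 2 $ 1 - (1 / 2 * exp (q $ 1) * u $ 1 * (q $ 2)\<^sup>2 * X 3 q
          + exp (q $ 1) * q $ 2 * u $ 2 * X 3 q + 1 / 2 * exp (q $ 1) * (q $ 2)\<^sup>2 * S q u 3 $ 1))) (at q)"
        by (rule has_derivative_eq_rhs, (rule derivative_eq_intros dX[OF q] component_has_derivative refl)+)
          (simp add: algebra_simps fun_eq_iff)
      from has_derivative_eq_on_open[OF U q _ dS[OF q] this, of "axis 1 1" 1 1 "axis 2 1"]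
      show ?thesis
        by (simp add: Svals q X_def wave_christoffel_def axis_component)
    qed
    moreover have "dir_deriv (\<lambda>q. S q (axis 2 1) 1) q (axis 1 1) $ 1 = - exp (q $ 1) * q $ 2 * X 3 q"
    proof -
      have "((\<lambda>q. - exp (q $ 1) * q $ 2 * X 3 q)
        has_derivative (\<lambda>u. - exp (q $ 1) * u $ 1 * q $ 2 * X 3 q - exp (q $ 1) * u $ 2 * X 3 q
          - exp (q $ 1) * q $ 2 * S q u 3 $ 1)) (at q)"
        by (rule has_derivative_eq_rhs, (rule derivative_eq_intros dX[OF q] component_has_derivative refl)+)
          (simp add: algebra_simps fun_eq_iff)
      from has_derivative_eq_on_open[OF U q _ dS[OF q] this, of "axis 2 1" 1 1 "axis 1 1"]
      show ?thesis
        by (simp add: Svals q X_def wave_christoffel_def axis_component)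
    qed
    ultimately show ?thesis using commute[OF q, of "axis 1 1" 1 "axis 2 1"] by simp
  qed
  have X3: "X 3 q = 0" if q: "q \<in> U" for q
  proof -
    have "q $ 2 * X 3 q = 0" if "q \<in> U" for q
    proof -
      have "S q (axis 1 1) 2 $ 1 = 0"
        using has_derivative_eq_on_open[OF U that X2 dX[OF that] has_derivative_const] .
      then show ?thesis by (simp add: Svals that X_def wave_christoffel_def)
    qed
    \<comment> \<open>Points with y = 0 require one more derivative: differentiating the product in
      y leaves \<open>X 3 q\<close>, because the y-derivative of \<open>X 3\<close> is zero.\<close>
    moreover have "((\<lambda>q. q $ 2 * X 3 q) has_derivative (\<lambda>u. q $ 2 * S q u 3 $ 1 + u $ 2 * X 3 q)) (at q)"
      by (intro has_derivative_mult component_has_derivative dX[OF q])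
    ultimately have "q $ 2 * S q (axis 2 1) 3 $ 1 + (axis 2 1 :: real^3) $ 2 * X 3 q = 0"
      by (rule has_derivative_eq_on_open[OF U q _ _ has_derivative_const])
    then show ?thesis by (simp add: Svals q wave_christoffel_def axis_component)
  qed
  have Y2: "Y 2 q \<noteq> 0" and Y3: "Y 3 q = 0" if q: "q \<in> U" for q
  proof -
    have "(Y 2 q)\<^sup>2 = 1" "(Y 3 q)\<^sup>2 = 0"
      using iso[OF q, of "axis 2 1" "axis 2 1"] iso[OF q, of "axis 3 1" "axis 3 1"] X2[OF q] X3[OF q]
      by (simp_all add: metric_form_wave_h wave_form_def axis_component X_def Y_def a_def power2_eq_square)
    then show "Y 2 q \<noteq> 0" "Y 3 q = 0" by auto
  qed
  have scale: "exp (q $ 1) = (X 1 q)\<^sup>2 * exp (\<psi> q $ 1)" if q: "q \<in> U" for q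
  proof -
    \<comment> \<open>The same comparison of mixed derivatives for the second component. The
      function here is that component of \<open>S q (axis 1 1) 1\<close>, with
      \<open>Y 3 = 0\<close> inserted; its y-derivative must vanish, as
      \<open>S q (axis 2 1) 1\<close> has second component 0.\<close>
    have "((\<lambda>q. exp (q $ 1) * q $ 2 * Y 2 q - (X 1 q)\<^sup>2 * exp (\<psi> q $ 1) * \<psi> q $ 2)
      has_derivative (\<lambda>u. exp (q $ 1) * u $ 1 * q $ 2 * Y 2 q + exp (q $ 1) * u $ 2 * Y 2 q
        + exp (q $ 1) * q $ 2 * S q u 2 $ 2 - (2 * X 1 q * S q u 1 $ 1 * exp (\<psi> q $ 1) * \<psi> q $ 2
        + (X 1 q)\<^sup>2 * exp (\<psi> q $ 1) * dir_deriv \<psi> q u $ 1 * \<psi> q $ 2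
        + (X 1 q)\<^sup>2 * exp (\<psi> q $ 1) * dir_deriv \<psi> q u $ 2))) (at q)"
      by (rule has_derivative_eq_rhs,
          (rule derivative_eq_intros dX[OF q] dY[OF q] d\<psi>[OF q] component_has_derivative refl)+)
        (simp add: algebra_simps fun_eq_iff)
    from has_derivative_eq_on_open[OF U q _ dS[OF q] this, of "axis 1 1" 1 2 "axis 2 1"]
    have "dir_deriv (\<lambda>q. S q (axis 1 1) 1) q (axis 2 1) $ 2
        = exp (q $ 1) * Y 2 q - (X 1 q)\<^sup>2 * exp (\<psi> q $ 1) * Y 2 q"
      using X2[OF q] X3[OF q] Y3
      by (simp add: Svals q X_def Y_def wave_christoffel_def axis_component exp power2_eq_square
          flip: a_def)
    moreover have "S r (axis 2 1) 1 $ 2 = 0" if "r \<in> U" for r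
      using that X2[OF that] Y3[OF that] by (simp add: Svals X_def Y_def wave_christoffel_def)
    from has_derivative_eq_on_open[OF U q this dS[OF q] has_derivative_const]
    have "dir_deriv (\<lambda>q. S q (axis 2 1) 1) q (axis 1 1) $ 2 = 0" by simp
    ultimately show ?thesis
      using commute[OF q, of "axis 1 1" 1 "axis 2 1"] Y2[OF q] by (simp flip: left_diff_distrib)
  qed
  have rhs: "((\<lambda>q. (X 1 q)\<^sup>2 * exp (\<psi> q $ 1)) has_derivative (\<lambda>u. 2 * X 1 p * S p u 1 $ 1 * exp (\<psi> p $ 1)
      + (X 1 p)\<^sup>2 * exp (\<psi> p $ 1) * dir_deriv \<psi> p u $ 1)) (at p)"
    by (rule has_derivative_eq_rhs,
        (rule derivative_eq_intros dX[OF p] d\<psi>[OF p] component_has_derivative refl)+)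
      (simp add: algebra_simps fun_eq_iff)
  have lhs: "((\<lambda>q::real^3. exp (q $ 1)) has_derivative (\<lambda>u. exp (p $ 1) * u $ 1)) (at p)"
    by (rule has_derivative_eq_rhs, (rule derivative_eq_intros component_has_derivative refl)+)
      (simp add: algebra_simps fun_eq_iff)
  have "exp (p $ 1) * (axis 1 1 :: real^3) $ 1 = 2 * X 1 p * S p (axis 1 1) 1 $ 1 * exp (\<psi> p $ 1)
      + (X 1 p)\<^sup>2 * exp (\<psi> p $ 1) * dir_deriv \<psi> p (axis 1 1) $ 1"
    by (rule has_derivative_eq_on_open[OF U p scale lhs rhs])
  \<comment> \<open>Since X'' = 0, the x-derivative of X'^2 exp X is X'^3 exp X, that is X' exp x,
    and comparison with exp x gives X' = 1.\<close>
  moreover have "S p (axis 1 1) 1 $ 1 = 0"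
    using X2[OF p] X3[OF p] p by (simp add: Svals X_def wave_christoffel_def)
  ultimately have "exp (p $ 1) = exp (p $ 1) * X 1 p"
    using scale[OF p] by (simp add: axis_component X_def a_def)
  then have "X 1 p = 1" by simp
  then show ?thesis using scale[OF p] by simp
qed

end

end

section \<open>The implications and their failure\<close>

lemma elementary_component: "elementary (\<lambda>p::real^3. p $ i)"
  by (intro elementary.linear bounded_linear_vec_nth)

lemma wave_coordinate_smooth_on:
  assumes "elementary (\<lambda>p::real^3. H (p $ 1))"
  shows "smooth_on U (\<lambda>p::real^3. 1 / 2 * H (p $ 1) * (p $ 2)\<^sup>2)"
  unfolding power2_eq_square
  by (intro elementary_smooth_on elementary.mult elementary.const elementary_component assms)

lemma pseudo_riemannian_Mf:
  assumes "open U" "elementary (\<lambda>p::real^3. f (p $ 1) (p $ 2))"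
  shows "pseudo_riemannian (Mf U f)"
  unfolding Mf_eq
proof (rule pseudo_riemannian_chart_manifold[OF assms(1)])
  have "elementary (\<lambda>p::real^3. - 2 * f (p $ 1) (p $ 2))"
    by (intro elementary.mult elementary.const assms)
  then have "elementary (\<lambda>p. wave_metric f p $ i $ j)" for i j
    using exhaust_3[of i] exhaust_3[of j]
    by (auto simp: wave_metric_def intro: elementary.const)
  then show "smooth_on U (wave_metric f)" by (rule matrix_elementary_smooth_on)
qed (simp add: wave_metric_nondegenerate)

lemma chart_isometry:
  assumes "isometric_on (chart_manifold UNIV g) U \<psi>"
  shows "open U" "smooth_on U \<psi>"
    "p \<in> U \<Longrightarrow> metric_form g p v w = metric_form g (\<psi> p) (dir_deriv \<psi> p v) (dir_deriv \<psi> p w)"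
proof -
  have "inv_into UNIV (\<lambda>p::real^'a. p) = (\<lambda>p. p)"
    by (rule ext) (metis inj_on_def inv_f_f)
  then have "coord_rep (UNIV, \<lambda>p. p) (UNIV, \<lambda>p. p) \<psi> = \<psi>"
    by (simp add: coord_rep_def comp_def)
  then show "open U" "smooth_on U \<psi>"
    "p \<in> U \<Longrightarrow> metric_form g p v w = metric_form g (\<psi> p) (dir_deriv \<psi> p v) (dir_deriv \<psi> p w)"
    using assms by (simp_all add: isometric_on_def Let_def)
qed

text \<open>The derivatives \<open>exp x - 2\<^sup>n exp (2 x)\<close> of the profile are positive for \<open>x < - n ln 2\<close>
  and vanish at \<open>- n ln 2\<close>.\<close>

lemma exists_variable_curv_hom_Suc_fails:
  "\<exists>(U :: (real^3) set) (f :: real \<Rightarrow> real \<Rightarrow> real).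
    open U \<and> connected U \<and> U \<noteq> {} \<and> smooth_on U (\<lambda>p. f (p $ 1) (p $ 2)) \<and>
    variable_curv_hom k (Mf U f) \<and> \<not> variable_curv_hom (k + 1) (Mf U f)"
proof -
  define h :: "nat \<Rightarrow> real \<Rightarrow> real" where "h n x = exp x - 2 ^ n * exp (2 * x)" for n x
  define U :: "(real^3) set" where "U = {p. p $ 1 < - real k * ln 2}"
  have h: "(h n has_real_derivative h (Suc n) x) (at x)" for n x
    unfolding h_def by (auto intro!: derivative_eq_intros)
  have factor: "h n x = exp x * (1 - 2 ^ n * exp x)" for n x
    using exp_add[of x x] by (simp add: h_def algebra_simps)
  have exp_ln: "exp (- real n * ln 2) = 1 / 2 ^ n" for n
    by (simp add: exp_minus exp_of_nat_mult divide_inverse)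
  have U: "open U" "connected U"
  proof -
    have eq: "U = (\<lambda>p. p $ 1) -` {..<- real k * ln 2}" by (auto simp: U_def)
    show "open U"
      unfolding eq by (intro open_vimage continuous_intros open_lessThan)
    show "connected U"
      unfolding eq by (intro convex_connected convex_linear_vimage bounded_linear.linear
          bounded_linear_vec_nth) auto
  qed
  \<comment> \<open>Both points lie to the left of the boundary \<open>- k ln 2\<close>; the factor
    \<open>1 - 2^(k+1) exp x\<close> is 1/2 at \<open>p\<close> and 0 at \<open>q\<close>.\<close>
  define p q :: "real^3" where "p = (- real (k + 2) * ln 2) *\<^sub>R axis 1 1"
    and "q = (- real (k + 1) * ln 2) *\<^sub>R axis 1 1"
  have pq1: "p $ 1 = - real (k + 2) * ln 2" "q $ 1 = - real (k + 1) * ln 2"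
    by (simp_all add: p_def q_def axis_component)
  have pq: "p \<in> U" "q \<in> U"
    unfolding U_def mem_Collect_eq pq1 by (simp_all add: algebra_simps)
  have "h l (p $ 1) > 0" if "l \<le> k" "p \<in> U" for l p
  proof -
    have "exp (p $ 1) < 1 / 2 ^ k"
      using that(2) unfolding exp_ln[symmetric] by (simp add: U_def)
    then have "2 ^ k * exp (p $ 1) < 1" by (simp add: field_simps)
    moreover have "2 ^ l * exp (p $ 1) \<le> 2 ^ k * exp (p $ 1)"
      using that(1) by (simp add: power_increasing)
    ultimately have "2 ^ l * exp (p $ 1) < 1" by linarith
    then show ?thesis by (simp add: factor zero_less_mult_iff)
  qed
  then have "variable_curv_hom k (wave_manifold h U)"
    by (rule variable_curv_hom_wave[where h = h, OF h])
  moreover have "\<not> variable_curv_hom (k + 1) (wave_manifold h U)"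
  proof (rule not_variable_curv_hom_wave[where h = h, OF h pq])
    show "h (k + 1) (p $ 1) \<noteq> 0" "h (k + 1) (q $ 1) = 0"
      unfolding factor pq1 exp_ln by simp_all
  qed
  moreover have "elementary (\<lambda>p::real^3. h 0 (p $ 1))"
  proof -
    have "elementary (\<lambda>p::real^3. exp (p $ 1) + - 1 * exp (2 * p $ 1))"
      by (intro elementary.intros elementary_component)
    then show ?thesis by (simp add: h_def)
  qed
  ultimately show ?thesis
    using U pq wave_coordinate_smooth_on[of "h 0" U]
    by (intro exI[of _ U] exI[of _ "\<lambda>x y. 1 / 2 * h 0 x * y\<^sup>2"])
      (auto simp: wave_manifold_def)
qed

lemma exponential_wave:
  "variable_curv_hom k (Mf UNIV (\<lambda>x y. 1 / 2 * exp x * y\<^sup>2))"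
  "1 \<le> k \<Longrightarrow> \<not> homothety_curv_hom k (Mf UNIV (\<lambda>x y. 1 / 2 * exp x * y\<^sup>2))"
  "\<not> locally_homogeneous (Mf UNIV (\<lambda>x y. 1 / 2 * exp x * y\<^sup>2))"
  "pseudo_riemannian (Mf UNIV (\<lambda>x y. 1 / 2 * exp x * y\<^sup>2))"
proof -
  let ?h = "\<lambda>n::nat. exp :: real \<Rightarrow> real"
  have eq: "Mf UNIV (\<lambda>x y. 1 / 2 * exp x * y\<^sup>2) = wave_manifold ?h UNIV"
    by (simp add: wave_manifold_def)
  have h: "(?h n has_real_derivative ?h (Suc n) x) (at x)" for n x
    by (rule DERIV_exp)
  show "variable_curv_hom k (Mf UNIV (\<lambda>x y. 1 / 2 * exp x * y\<^sup>2))"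
    unfolding eq by (rule variable_curv_hom_wave[where h = ?h, OF h]) simp
  \<comment> \<open>The exponential is its own derivative, so levels 0 and 1 agree at both points,
    with the distinct values 1 and e.\<close>
  show "\<not> homothety_curv_hom k (Mf UNIV (\<lambda>x y. 1 / 2 * exp x * y\<^sup>2))" if "1 \<le> k"
    unfolding eq
    by (rule not_homothety_curv_hom_wave[where h = ?h, OF h, of 0 UNIV "axis 1 1"])
      (use that in \<open>auto simp: axis_component\<close>)
  show "\<not> locally_homogeneous (Mf UNIV (\<lambda>x y. 1 / 2 * exp x * y\<^sup>2))"
  proof
    assume "locally_homogeneous (Mf UNIV (\<lambda>x y. 1 / 2 * exp x * y\<^sup>2))"
    then obtain U \<psi> where \<psi>: "0 \<in> U" "\<psi> 0 = axis 1 1"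
      "isometric_on (chart_manifold UNIV (wave ?h)) U \<psi>"
      unfolding eq wave_manifold_eq locally_homogeneous_def chart_manifold_simps(1) topspace_euclidean_subtopology
      by (metis UNIV_I)
    \<comment> \<open>A local isometry preserves x, yet the two chosen points have x = 0 and x =
      1.\<close>
    have "\<psi> 0 $ 1 = (0 :: real^3) $ 1"
      by (rule exponential_isometry_fixes_x[where h = ?h, OF h])
        (use chart_isometry[OF \<psi>(3)] \<psi>(1) in auto)
    then show False by (simp add: \<psi>(2) axis_component)
  qed
  show "pseudo_riemannian (Mf UNIV (\<lambda>x y. 1 / 2 * exp x * y\<^sup>2))"
    unfolding power2_eq_square
    by (intro pseudo_riemannian_Mf elementary.intros elementary_component open_UNIV)
qed

lemma curv_hom_implications:
  "curv_hom k M \<Longrightarrow> homothety_curv_hom k M"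
  "homothety_curv_hom k M \<Longrightarrow> variable_homothety_curv_hom k M"
  "curv_hom k M \<Longrightarrow> variable_curv_hom k M"
  "variable_curv_hom k M \<Longrightarrow> variable_homothety_curv_hom k M"
proof -
  have "homothety_curv_hom_model k M B A" if "curv_hom_model k M B A"
    for B :: "real^'b \<Rightarrow> real^'b \<Rightarrow> real" and A
    using that unfolding curv_hom_model_def homothety_curv_hom_model_def
    by (metis power_one zero_neq_one)
  then show "curv_hom k M \<Longrightarrow> homothety_curv_hom k M"
    unfolding curv_hom_def homothety_curv_hom_def by blast
  show "homothety_curv_hom k M \<Longrightarrow> variable_homothety_curv_hom k M"
    unfolding homothety_curv_hom_def variable_homothety_curv_hom_def
      homothety_curv_hom_model_def variable_homothety_curv_hom_model_def by metis
  show "curv_hom k M \<Longrightarrow> variable_curv_hom k M"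
    unfolding curv_hom_def variable_curv_hom_def curv_hom_model_def variable_curv_hom_model_def
    by metis
  have "variable_homothety_curv_hom_model k M B A" if "variable_curv_hom_model k M B A"
    for B :: "real^'b \<Rightarrow> real^'b \<Rightarrow> real" and A
    using that unfolding variable_curv_hom_model_def variable_homothety_curv_hom_model_def
    by (metis power_one zero_neq_one)
  then show "variable_curv_hom k M \<Longrightarrow> variable_homothety_curv_hom k M"
    unfolding variable_curv_hom_def variable_homothety_curv_hom_def by blast
qed

theorem theorem1p18:
  shows
    "(\<forall>k::nat. 1 \<le> k \<longrightarrow>
       (\<exists>(U :: (real^3) set) (f :: real \<Rightarrow> real \<Rightarrow> real).
          open U \<and> connected U \<and> U \<noteq> {} \<and> smooth_on U (\<lambda>p. f (p $ 1) (p $ 2)) \<and>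
          variable_curv_hom k (Mf U f) \<and> \<not> variable_curv_hom (k + 1) (Mf U f)))
   \<and> ((\<forall>k::nat. variable_curv_hom k (Mf UNIV (\<lambda>x y. 1 / 2 * exp x * y\<^sup>2))) \<and>
      \<not> homothety_curv_hom 1 (Mf UNIV (\<lambda>x y. 1 / 2 * exp x * y\<^sup>2)) \<and>
      \<not> locally_homogeneous (Mf UNIV (\<lambda>x y. 1 / 2 * exp x * y\<^sup>2)))
   \<and> ((\<forall>(k::nat) (M :: ('a, 'n::finite) pr_manifold). pseudo_riemannian M \<longrightarrow>
         (curv_hom k M \<longrightarrow> homothety_curv_hom k M) \<and>
         (homothety_curv_hom k M \<longrightarrow> variable_homothety_curv_hom k M) \<and>
         (curv_hom k M \<longrightarrow> variable_curv_hom k M) \<and>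
         (variable_curv_hom k M \<longrightarrow> variable_homothety_curv_hom k M)) \<and>
      (\<forall>k::nat. 1 \<le> k \<longrightarrow>
         (\<exists>M :: (real^3, 3) pr_manifold. pseudo_riemannian M \<and> connected_space (topol M) \<and>
            homothety_curv_hom k M \<and> \<not> curv_hom k M) \<and>
         (\<exists>M :: (real^3, 3) pr_manifold. pseudo_riemannian M \<and> connected_space (topol M) \<and>
            homothety_curv_hom k M \<and> \<not> variable_curv_hom k M) \<and>
         (\<exists>M :: (real^3, 3) pr_manifold. pseudo_riemannian M \<and> connected_space (topol M) \<and>
            variable_curv_hom k M \<and> \<not> curv_hom k M) \<and>
         (\<exists>M :: (real^3, 3) pr_manifold. pseudo_riemannian M \<and> connected_space (topol M) \<and>
            variable_curv_hom k M \<and> \<not> homothety_curv_hom k M) \<and>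
         (\<exists>M :: (real^3, 3) pr_manifold. pseudo_riemannian M \<and> connected_space (topol M) \<and>
            variable_homothety_curv_hom k M \<and> \<not> curv_hom k M) \<and>
         (\<exists>M :: (real^3, 3) pr_manifold. pseudo_riemannian M \<and> connected_space (topol M) \<and>
            variable_homothety_curv_hom k M \<and> \<not> homothety_curv_hom k M) \<and>
         (\<exists>M :: (real^3, 3) pr_manifold. pseudo_riemannian M \<and> connected_space (topol M) \<and>
            variable_homothety_curv_hom k M \<and> \<not> variable_curv_hom k M)))"
proof (intro conjI allI impI)
  let ?W = "Mf UNIV (\<lambda>x y. 1 / 2 * exp x * y\<^sup>2)"
  have W: "connected_space (topol ?W)"
    unfolding Mf_eq chart_manifold_simps
    by (rule connected_space_subtopology) (simp add: connected_UNIV)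
  have C: "connected_space (topol cone_manifold)"
    by (simp add: connected_space_subtopology cone_domain)
  \<comment> \<open>The cone separates \<open>homothety_curv_hom\<close> from
    \<open>variable_curv_hom\<close>, and the exponential wave separates them the other way once
    level 1 is included. The remaining five failures follow from these two by the positive
    implications.\<close>
  note C = pseudo_riemannian_cone C homothety_curv_hom_cone not_variable_curv_hom_cone
  note W = exponential_wave(4) W exponential_wave(1,2)
  fix k :: nat
  show "\<exists>(U :: (real^3) set) (f :: real \<Rightarrow> real \<Rightarrow> real).
          open U \<and> connected U \<and> U \<noteq> {} \<and> smooth_on U (\<lambda>p. f (p $ 1) (p $ 2)) \<and>
          variable_curv_hom k (Mf U f) \<and> \<not> variable_curv_hom (k + 1) (Mf U f)"
    by (rule exists_variable_curv_hom_Suc_fails)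
  assume k: "1 \<le> k"
  show "\<exists>M :: (real^3, 3) pr_manifold. pseudo_riemannian M \<and> connected_space (topol M) \<and>
      homothety_curv_hom k M \<and> \<not> curv_hom k M"
    "\<exists>M :: (real^3, 3) pr_manifold. pseudo_riemannian M \<and> connected_space (topol M) \<and>
      homothety_curv_hom k M \<and> \<not> variable_curv_hom k M"
    "\<exists>M :: (real^3, 3) pr_manifold. pseudo_riemannian M \<and> connected_space (topol M) \<and>
      variable_homothety_curv_hom k M \<and> \<not> curv_hom k M"
    "\<exists>M :: (real^3, 3) pr_manifold. pseudo_riemannian M \<and> connected_space (topol M) \<and>
      variable_homothety_curv_hom k M \<and> \<not> variable_curv_hom k M"
    using C curv_hom_implications by blast+
  show "\<exists>M :: (real^3, 3) pr_manifold. pseudo_riemannian M \<and> connected_space (topol M) \<and>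
      variable_curv_hom k M \<and> \<not> curv_hom k M"
    "\<exists>M :: (real^3, 3) pr_manifold. pseudo_riemannian M \<and> connected_space (topol M) \<and>
      variable_curv_hom k M \<and> \<not> homothety_curv_hom k M"
    "\<exists>M :: (real^3, 3) pr_manifold. pseudo_riemannian M \<and> connected_space (topol M) \<and>
      variable_homothety_curv_hom k M \<and> \<not> homothety_curv_hom k M"
    using W(1-3) W(4)[OF k] curv_hom_implications by blast+
qed (use exponential_wave curv_hom_implications in auto)

end
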